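(* Let $\mathcal{G}$ be a locally compact étale groupoid and $T\in\mathcal{L}(L^2(\mathcal{G}))$. Then: (1) $T$ is supported in a compact set $K\subseteq\mathcal{G}$ if and only if $\chi_{A_x}\Phi_x(T)\chi_{B_x}=0$ for any $x\in\mathcal{G}^{(0)}$ and subsets $A_x,B_x\subseteq\mathcal{G}_x$ with $A_x\cap(K\cdot B_x)=\emptyset$ and $(K\cdot A_x)\cap B_x=\emptyset$; (2) $T$ is quasi-local if and only if for any $\varepsilon>0$ there exists a compact subset $K\subseteq\mathcal{G}$ such that $\|\chi_{A_x}\Phi_x(T)\chi_{B_x}\|<\varepsilon$ for any $x\in\mathcal{G}^{(0)}$ and subsets $A_x,B_x\subseteq\mathcal{G}_x$ with $A_x\cap(K\cdot B_x)=\emptyset$ and $(K\cdot A_x)\cap B_x=\emptyset$.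
   Context: Locally compact spaces are assumed Hausdorff. A locally compact étale groupoid $\mathcal{G}$ is a topological groupoid with locally compact topology whose range map $\mathrm{r}$ (hence source map $\mathrm{s}$) is a local homeomorphism; $\mathcal{G}^{(0)}$ is its unit space and $\mathcal{G}_x=\mathrm{s}^{-1}(x)$ (discrete). For $A,B\subseteq\mathcal{G}$, $A\cdot B=\{\alpha\beta:\alpha\in A,\beta\in B,\mathrm{s}(\alpha)=\mathrm{r}(\beta)\}$. Functions act by pointwise multiplication. $L^2(\mathcal{G})$ is the Hilbert $C_0(\mathcal{G}^{(0)})$-module obtained by completing $C_c(\mathcal{G})$ for $\langle\eta,\xi\rangle(x)=\sum_{\gamma\in\mathcal{G}_x}\overline{\eta(\gamma)}\xi(\gamma)$, with $(\xi f)(\gamma)=\xi(\gamma)f(\mathrm{s}(\gamma))$; its elements are regarded as functions in $C_0(\mathcal{G})$. $\mathcal{L}(L^2(\mathcal{G}))$ is the $C^*$-algebra of adjointable operators. The slice $\Phi_x(T)\in\mathcal{B}(\ell^2(\mathcal{G}_x))$ is defined by $\Phi_x(T)(\xi|_{\mathcal{G}_x})=T(\xi)|_{\mathcal{G}_x}$ for $\xi\in L^2(\mathcal{G})$. For $K\subseteq\mathcal{G}$, $f,g\in C_b(\mathcal{G})$ are $K$-separated if $(K\cdot\mathrm{supp}(f))\cap\mathrm{supp}(g)=\emptyset$ and $\mathrm{supp}(f)\cap(K\cdot\mathrm{supp}(g))=\emptyset$. $T$ is supported in $K$ if $gTf=0$ for all $K$-separated $f,g\in C_b(\mathcal{G})$.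 $T$ is quasi-local if for any $\varepsilon>0$ there is a compact $K\subseteq\mathcal{G}$ such that $\|gTf\|<\varepsilon\|g\|_\infty\|f\|_\infty$ (read as $\le$ when $f=0$ or $g=0$) for all $K$-separated $f,g\in C_b(\mathcal{G})$. *)

theory Defs
  imports "HOL-Analysis.Analysis"
begin

section \<open>Locally compact etale groupoids\<close>

text \<open>The arrows of the groupoid are all elements of the type \<open>'g\<close>. The product
  \<open>mul G \<alpha> \<beta>\<close> is meaningful only if \<open>src G \<alpha> = rng G \<beta>\<close>; its value
  elsewhere is arbitrary and never used.\<close>

record 'g groupoid_ops =
  rng :: "'g \<Rightarrow> 'g"
  src :: "'g \<Rightarrow> 'g"
  mul :: "'g \<Rightarrow> 'g \<Rightarrow> 'g"
  ginv :: "'g \<Rightarrow> 'g"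

definition units :: "'g groupoid_ops \<Rightarrow> 'g set" where
  "units G = range (src G)"

definition fibre :: "'g groupoid_ops \<Rightarrow> 'g \<Rightarrow> 'g set" where
  "fibre G x = {\<gamma>. src G \<gamma> = x}"

definition composable :: "'g groupoid_ops \<Rightarrow> ('g \<times> 'g) set" where
  "composable G = {(\<alpha>, \<beta>). src G \<alpha> = rng G \<beta>}"

definition set_mul :: "'g groupoid_ops \<Rightarrow> 'g set \<Rightarrow> 'g set \<Rightarrow> 'g set" where
  "set_mul G A B = {mul G \<alpha> \<beta> | \<alpha> \<beta>. \<alpha> \<in> A \<and> \<beta> \<in> B \<and> src G \<alpha> = rng G \<beta>}"

locale groupoid =
  fixes G :: "'g groupoid_ops"
  assumes rng_src: "rng G (src G \<alpha>) = src G \<alpha>"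
    and src_src: "src G (src G \<alpha>) = src G \<alpha>"
    and rng_rng: "rng G (rng G \<alpha>) = rng G \<alpha>"
    and src_rng: "src G (rng G \<alpha>) = rng G \<alpha>"
    and src_mul: "src G \<alpha> = rng G \<beta> \<Longrightarrow> src G (mul G \<alpha> \<beta>) = src G \<beta>"
    and rng_mul: "src G \<alpha> = rng G \<beta> \<Longrightarrow> rng G (mul G \<alpha> \<beta>) = rng G \<alpha>"
    and mul_assoc: "\<lbrakk>src G \<alpha> = rng G \<beta>; src G \<beta> = rng G \<gamma>\<rbrakk> \<Longrightarrow>
      mul G (mul G \<alpha> \<beta>) \<gamma> = mul G \<alpha> (mul G \<beta> \<gamma>)"
    and rng_mul_left: "mul G (rng G \<alpha>) \<alpha> = \<alpha>"
    and mul_src_right: "mul G \<alpha> (src G \<alpha>) = \<alpha>"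
    and src_ginv: "src G (ginv G \<alpha>) = rng G \<alpha>"
    and rng_ginv: "rng G (ginv G \<alpha>) = src G \<alpha>"
    and ginv_mul: "mul G (ginv G \<alpha>) \<alpha> = src G \<alpha>"
    and mul_ginv: "mul G \<alpha> (ginv G \<alpha>) = rng G \<alpha>"

locale topological_groupoid = groupoid G
  for G :: "'g::topological_space groupoid_ops" +
  assumes continuous_mul: "continuous_on (composable G) (\<lambda>(\<alpha>, \<beta>). mul G \<alpha> \<beta>)"
    and continuous_ginv: "continuous_on UNIV (ginv G)"

definition local_homeomorphism :: "'a set \<Rightarrow> 'b set \<Rightarrow> ('a::topological_space \<Rightarrow> 'b::topological_space) \<Rightarrow> bool" where
  "local_homeomorphism X Y f \<longleftrightarrow> f ` X \<subseteq> Y \<and>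
     (\<forall>x\<in>X. \<exists>U. openin (top_of_set X) U \<and> x \<in> U \<and> openin (top_of_set Y) (f ` U) \<and>
        (\<exists>h. homeomorphism U (f ` U) f h))"

locale lc_etale_groupoid = topological_groupoid G
  for G :: "'g::t2_space groupoid_ops" +
  assumes locally_compact: "locally_compact_space (euclidean :: 'g topology)"
    and etale: "local_homeomorphism UNIV (units G) (rng G)"

section \<open>The Hilbert module of the groupoid\<close>

definition Cc :: "('g::topological_space \<Rightarrow> complex) set" where
  "Cc = {\<xi>. continuous_on UNIV \<xi> \<and> compact (closure {\<gamma>. \<xi> \<gamma> \<noteq> 0})}"

definition L2_inner :: "'g groupoid_ops \<Rightarrow> ('g \<Rightarrow> complex) \<Rightarrow> ('g \<Rightarrow> complex) \<Rightarrow> 'g \<Rightarrow> complex" where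
  "L2_inner G \<eta> \<xi> x = (\<Sum>\<^sub>\<infinity>\<gamma>\<in>fibre G x. cnj (\<eta> \<gamma>) * \<xi> \<gamma>)"

definition L2_norm :: "'g groupoid_ops \<Rightarrow> ('g \<Rightarrow> complex) \<Rightarrow> real" where
  "L2_norm G \<xi> = sqrt (SUP x\<in>units G. cmod (L2_inner G \<xi> \<xi> x))"

text \<open>The completion of \<open>Cc\<close>, realised as functions on the groupoid: since
  \<open>cmod (\<xi> \<gamma>) \<le> L2_norm G \<xi>\<close>, a sequence in \<open>Cc\<close> that is Cauchy for
  \<open>L2_norm\<close> converges uniformly, and the element of the completion that it represents is
  identified with its limit function. \<open>L2_inner\<close> and \<open>L2_norm\<close> applied to such limit
  functions are the continuous extensions of the inner product and the norm of \<open>Cc\<close>.\<close>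

definition L2 :: "'g::topological_space groupoid_ops \<Rightarrow> ('g \<Rightarrow> complex) set" where
  "L2 G = {\<xi>. \<exists>\<eta> :: nat \<Rightarrow> 'g \<Rightarrow> complex.
     (\<forall>n. \<eta> n \<in> Cc) \<and>
     (\<forall>\<epsilon>>0. \<exists>N. \<forall>m\<ge>N. \<forall>n\<ge>N. L2_norm G (\<lambda>\<gamma>. \<eta> m \<gamma> - \<eta> n \<gamma>) < \<epsilon>) \<and>
     (\<forall>\<gamma>. (\<lambda>n. \<eta> n \<gamma>) \<longlonglongrightarrow> \<xi> \<gamma>)}"

text \<open>As usual for Hilbert modules, only the existence of an adjoint is required; linearity over the
  scalars and the coefficient algebra and boundedness follow. The values of \<open>T\<close> outside
  \<open>L2 G\<close> are irrelevant.\<close>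

definition adjointable :: "'g::topological_space groupoid_ops \<Rightarrow>
    (('g \<Rightarrow> complex) \<Rightarrow> ('g \<Rightarrow> complex)) set" where
  "adjointable G = {T. T \<in> L2 G \<rightarrow> L2 G \<and>
     (\<exists>S \<in> L2 G \<rightarrow> L2 G. \<forall>\<eta>\<in>L2 G. \<forall>\<xi>\<in>L2 G. \<forall>x\<in>units G.
        L2_inner G (T \<eta>) \<xi> x = L2_inner G \<eta> (S \<xi>) x)}"

definition op_norm :: "'v set \<Rightarrow> ('v \<Rightarrow> real) \<Rightarrow> ('v \<Rightarrow> 'v) \<Rightarrow> real" where
  "op_norm V N S = (SUP v\<in>{v\<in>V. N v \<le> 1}. N (S v))"

definition mult_op :: "('g \<Rightarrow> complex) \<Rightarrow> ('g \<Rightarrow> complex) \<Rightarrow> ('g \<Rightarrow> complex)" where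
  "mult_op f \<xi> = (\<lambda>\<gamma>. f \<gamma> * \<xi> \<gamma>)"

section \<open>Slices\<close>

text \<open>The Hilbert space of square summable functions on \<open>A\<close>; its elements are extended by zero
  outside \<open>A\<close>.\<close>

definition ell2 :: "'g set \<Rightarrow> ('g \<Rightarrow> complex) set" where
  "ell2 A = {v. (\<forall>\<gamma>. \<gamma> \<notin> A \<longrightarrow> v \<gamma> = 0) \<and> (\<lambda>\<gamma>. (cmod (v \<gamma>))\<^sup>2) summable_on A}"

definition ell2_norm :: "'g set \<Rightarrow> ('g \<Rightarrow> complex) \<Rightarrow> real" where
  "ell2_norm A v = sqrt (\<Sum>\<^sub>\<infinity>\<gamma>\<in>A. (cmod (v \<gamma>))\<^sup>2)"

definition bounded_ops_ell2 :: "'g set \<Rightarrow> (('g \<Rightarrow> complex) \<Rightarrow> ('g \<Rightarrow> complex)) set" where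
  "bounded_ops_ell2 A = {S. S \<in> ell2 A \<rightarrow>\<^sub>E ell2 A \<and>
     (\<forall>v\<in>ell2 A. \<forall>w\<in>ell2 A. S (\<lambda>\<gamma>. v \<gamma> + w \<gamma>) = (\<lambda>\<gamma>. S v \<gamma> + S w \<gamma>)) \<and>
     (\<forall>c. \<forall>v\<in>ell2 A. S (\<lambda>\<gamma>. c * v \<gamma>) = (\<lambda>\<gamma>. c * S v \<gamma>)) \<and>
     (\<exists>C. \<forall>v\<in>ell2 A. ell2_norm A (S v) \<le> C * ell2_norm A v)}"

definition restr :: "'g set \<Rightarrow> ('g \<Rightarrow> complex) \<Rightarrow> ('g \<Rightarrow> complex)" where
  "restr A \<xi> = (\<lambda>\<gamma>. if \<gamma> \<in> A then \<xi> \<gamma> else 0)"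

text \<open>For adjointable \<open>T\<close> the operator described here exists and is unique, because every
  square summable function on a fibre is the restriction of an element of \<open>L2 G\<close>.\<close>

definition slice :: "'g::topological_space groupoid_ops \<Rightarrow> 'g \<Rightarrow>
    (('g \<Rightarrow> complex) \<Rightarrow> ('g \<Rightarrow> complex)) \<Rightarrow> ('g \<Rightarrow> complex) \<Rightarrow> ('g \<Rightarrow> complex)" where
  "slice G x T = (THE S. S \<in> bounded_ops_ell2 (fibre G x) \<and>
     (\<forall>\<xi>\<in>L2 G. S (restr (fibre G x) \<xi>) = restr (fibre G x) (T \<xi>)))"

section \<open>Supports and quasi-locality\<close>

definition supp :: "('g::topological_space \<Rightarrow>\<^sub>C complex) \<Rightarrow> 'g set" where
  "supp f = closure {\<gamma>. apply_bcontfun f \<gamma> \<noteq> 0}"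

definition K_separated :: "'g::topological_space groupoid_ops \<Rightarrow> 'g set \<Rightarrow>
    ('g \<Rightarrow>\<^sub>C complex) \<Rightarrow> ('g \<Rightarrow>\<^sub>C complex) \<Rightarrow> bool" where
  "K_separated G K f g \<longleftrightarrow>
     set_mul G K (supp f) \<inter> supp g = {} \<and> supp f \<inter> set_mul G K (supp g) = {}"

definition compress :: "('g \<Rightarrow> complex) \<Rightarrow> (('g \<Rightarrow> complex) \<Rightarrow> ('g \<Rightarrow> complex)) \<Rightarrow>
    ('g \<Rightarrow> complex) \<Rightarrow> (('g \<Rightarrow> complex) \<Rightarrow> ('g \<Rightarrow> complex))" where
  "compress g T f = mult_op g \<circ> T \<circ> mult_op f"

definition supported_in :: "'g::topological_space groupoid_ops \<Rightarrow>
    (('g \<Rightarrow> complex) \<Rightarrow> ('g \<Rightarrow> complex)) \<Rightarrow> 'g set \<Rightarrow> bool" where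
  "supported_in G T K \<longleftrightarrow> (\<forall>f g :: 'g \<Rightarrow>\<^sub>C complex. K_separated G K f g \<longrightarrow>
     (\<forall>\<xi>\<in>L2 G. compress (apply_bcontfun g) T (apply_bcontfun f) \<xi> = (\<lambda>_. 0)))"

text \<open>The strict inequality cannot hold if \<open>f\<close> or \<open>g\<close> vanishes and is then relaxed.\<close>

definition quasi_local :: "'g::topological_space groupoid_ops \<Rightarrow>
    (('g \<Rightarrow> complex) \<Rightarrow> ('g \<Rightarrow> complex)) \<Rightarrow> bool" where
  "quasi_local G T \<longleftrightarrow> (\<forall>\<epsilon>>0. \<exists>K. compact K \<and>
     (\<forall>f g :: 'g \<Rightarrow>\<^sub>C complex. K_separated G K f g \<longrightarrow>
        (let n = op_norm (L2 G) (L2_norm G) (compress (apply_bcontfun g) T (apply_bcontfun f))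
         in if f = 0 \<or> g = 0 then n \<le> \<epsilon> * norm g * norm f
            else n < \<epsilon> * norm g * norm f)))"

end

theory Submission
  imports Defs
begin

text \<open>An adjointable operator has an integral kernel: by adjointness,
  \<open>T \<xi> \<gamma> = \<langle>S \<delta>\<^sub>\<gamma>, \<xi>\<rangle>(s \<gamma>)\<close>, where \<open>S\<close> is the adjoint of \<open>T\<close> and \<open>\<delta>\<^sub>\<gamma>\<close> is a
  compactly supported function that restricts to the point mass at \<open>\<gamma>\<close> on the fibre of \<open>\<gamma>\<close>.
  The same kernel gives the slices, so entries of a slice between finite sets are read off from
  \<open>T\<close> applied to bump functions on disjoint open bisections, which extend finitely supported
  functions on a fibre without increasing the norm.

  If \<open>f\<close> and \<open>g\<close> are \<open>K\<close>-separated, then so are the traces of their supports on each fibre,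
  and \<open>g T f\<close> acts on that fibre as the cut-off slice multiplied by \<open>g\<close>. Conversely,
  \<open>K\<close>-separation of finite subsets \<open>A\<close> and \<open>B\<close> of a fibre says that the quotients
  \<open>\<alpha>\<beta>\<inverse>\<close> and \<open>\<beta>\<alpha>\<inverse>\<close> avoid the closed set \<open>K\<close>. This is an open condition, so \<open>A\<close> and \<open>B\<close> can be
  fattened to supports of \<open>K\<close>-separated functions; arbitrary \<open>A\<close> and \<open>B\<close> follow by exhausting
  them with finite subsets.\<close>

section \<open>Square summable functions\<close>

text \<open>Bounds the \<open>ell2_norm\<close> through finite partial sums. \<open>infsum\<close>
  is 0 on a non-summable family, so an inequality for \<open>ell2_norm\<close> alone would not show
  square summability; this form entails it and passes to pointwise limits.\<close>

definition l2_bound :: "'a set \<Rightarrow> real \<Rightarrow> ('a \<Rightarrow> complex) \<Rightarrow> bool" where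
  "l2_bound A c v \<longleftrightarrow> (\<forall>F. finite F \<and> F \<subseteq> A \<longrightarrow> L2_set (\<lambda>\<gamma>. cmod (v \<gamma>)) F \<le> c)"

lemma l2_boundI: "(\<And>F. finite F \<Longrightarrow> F \<subseteq> A \<Longrightarrow> L2_set (\<lambda>\<gamma>. cmod (v \<gamma>)) F \<le> c) \<Longrightarrow> l2_bound A c v"
  by (simp add: l2_bound_def)

lemma l2_boundD: "l2_bound A c v \<Longrightarrow> finite F \<Longrightarrow> F \<subseteq> A \<Longrightarrow> L2_set (\<lambda>\<gamma>. cmod (v \<gamma>)) F \<le> c"
  by (simp add: l2_bound_def)

lemma l2_bound_nonneg: "l2_bound A c v \<Longrightarrow> 0 \<le> c"
  using l2_boundD[of A c v "{}"] by simp

lemma l2_bound_point: "l2_bound A c v \<Longrightarrow> \<gamma> \<in> A \<Longrightarrow> cmod (v \<gamma>) \<le> c"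
  using l2_boundD[of A c v "{\<gamma>}"] by simp

lemma l2_bound_mono: "l2_bound A c v \<Longrightarrow> c \<le> d \<Longrightarrow> l2_bound A d v"
  by (meson l2_bound_def order_trans)

lemma l2_bound_dominated:
  assumes "l2_bound A c v" "0 \<le> M" "\<And>\<gamma>. \<gamma> \<in> A \<Longrightarrow> cmod (w \<gamma>) \<le> M * cmod (v \<gamma>)"
  shows "l2_bound A (M * c) w"
proof (rule l2_boundI)
  fix F assume F: "finite F" "F \<subseteq> A"
  have "L2_set (\<lambda>\<gamma>. cmod (w \<gamma>)) F \<le> L2_set (\<lambda>\<gamma>. M * cmod (v \<gamma>)) F"
    using assms F by (intro L2_set_mono) auto
  also have "\<dots> = M * L2_set (\<lambda>\<gamma>. cmod (v \<gamma>)) F"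
    by (simp add: L2_set_right_distrib assms)
  also have "\<dots> \<le> M * c"
    using assms F by (simp add: l2_boundD mult_left_mono)
  finally show "L2_set (\<lambda>\<gamma>. cmod (w \<gamma>)) F \<le> M * c" .
qed

lemma l2_bound_cong: "(\<And>\<gamma>. \<gamma> \<in> A \<Longrightarrow> v \<gamma> = w \<gamma>) \<Longrightarrow> l2_bound A c v \<Longrightarrow> l2_bound A c w"
  using l2_bound_dominated[of A c v 1 w] by simp

lemma l2_bound_scale: "l2_bound A c v \<Longrightarrow> l2_bound A (cmod a * c) (\<lambda>\<gamma>. a * v \<gamma>)"
  by (erule l2_bound_dominated) (auto simp: norm_mult)

lemma l2_bound_add:
  assumes "l2_bound A c v" "l2_bound A d w"
  shows "l2_bound A (c + d) (\<lambda>\<gamma>. v \<gamma> + w \<gamma>)"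
proof (rule l2_boundI)
  fix F assume F: "finite F" "F \<subseteq> A"
  have "L2_set (\<lambda>\<gamma>. cmod (v \<gamma> + w \<gamma>)) F \<le> L2_set (\<lambda>\<gamma>. cmod (v \<gamma>) + cmod (w \<gamma>)) F"
    by (intro L2_set_mono) (auto simp: norm_triangle_ineq)
  also have "\<dots> \<le> L2_set (\<lambda>\<gamma>. cmod (v \<gamma>)) F + L2_set (\<lambda>\<gamma>. cmod (w \<gamma>)) F"
    by (rule L2_set_triangle_ineq)
  also have "\<dots> \<le> c + d"
    using assms F by (intro add_mono l2_boundD)
  finally show "L2_set (\<lambda>\<gamma>. cmod (v \<gamma> + w \<gamma>)) F \<le> c + d" .
qed

lemma l2_bound_diff:
  assumes "l2_bound A c v" "l2_bound A d w"
  shows "l2_bound A (c + d) (\<lambda>\<gamma>. v \<gamma> - w \<gamma>)"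
  using l2_bound_add[OF assms(1) l2_bound_scale[OF assms(2), of "-1"]] by simp

text \<open>Each instance of the bound involves finitely many points, where pointwise convergence is
  enough. So balls are closed under pointwise limits, along any nontrivial filter.\<close>

lemma l2_bound_limit:
  assumes lim: "\<And>\<gamma>. \<gamma> \<in> A \<Longrightarrow> ((\<lambda>i. v i \<gamma>) \<longlongrightarrow> w \<gamma>) F" and "F \<noteq> bot"
    and ev: "\<forall>\<^sub>F i in F. l2_bound A c (v i)"
  shows "l2_bound A c w"
proof (rule l2_boundI)
  fix B assume B: "finite B" "B \<subseteq> A"
  have "((\<lambda>i. L2_set (\<lambda>\<gamma>. cmod (v i \<gamma>)) B) \<longlongrightarrow> L2_set (\<lambda>\<gamma>. cmod (w \<gamma>)) B) F"
    unfolding L2_set_def using B by (intro tendsto_intros lim) auto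
  moreover have "\<forall>\<^sub>F i in F. L2_set (\<lambda>\<gamma>. cmod (v i \<gamma>)) B \<le> c"
    using ev by eventually_elim (use B in \<open>auto dest: l2_boundD\<close>)
  ultimately show "L2_set (\<lambda>\<gamma>. cmod (w \<gamma>)) B \<le> c"
    using \<open>F \<noteq> bot\<close> by (rule tendsto_upperbound)
qed

lemma l2_bound_iff_sum:
  assumes "0 \<le> c"
  shows "l2_bound A c v \<longleftrightarrow> (\<forall>F. finite F \<and> F \<subseteq> A \<longrightarrow> (\<Sum>\<gamma>\<in>F. (cmod (v \<gamma>))\<^sup>2) \<le> c\<^sup>2)"
  unfolding l2_bound_def L2_set_def using assms
  by (simp add: real_sqrt_le_iff' sum_nonneg)

lemma l2_bound_summable:
  assumes "l2_bound A c v"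
  shows "(\<lambda>\<gamma>. (cmod (v \<gamma>))\<^sup>2) summable_on A"
proof -
  have "\<And>F. finite F \<Longrightarrow> F \<subseteq> A \<Longrightarrow> (\<Sum>\<gamma>\<in>F. (cmod (v \<gamma>))\<^sup>2) \<le> c\<^sup>2"
    using assms l2_bound_iff_sum[OF l2_bound_nonneg[OF assms]] by blast
  then show ?thesis
    by (intro nonneg_bdd_above_summable_on bdd_aboveI2[where M = "c\<^sup>2"]) auto
qed

lemma l2_bound_ell2_norm:
  assumes "(\<lambda>\<gamma>. (cmod (v \<gamma>))\<^sup>2) summable_on A"
  shows "l2_bound A (ell2_norm A v) v"
proof (rule l2_boundI)
  fix F assume F: "finite F" "F \<subseteq> A"
  show "L2_set (\<lambda>\<gamma>. cmod (v \<gamma>)) F \<le> ell2_norm A v"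
    unfolding L2_set_def ell2_norm_def
    using finite_sum_le_infsum[OF assms F] by simp
qed

lemma ell2_norm_le:
  assumes "l2_bound A c v"
  shows "ell2_norm A v \<le> c"
proof -
  have "(\<Sum>\<^sub>\<infinity>\<gamma>\<in>A. (cmod (v \<gamma>))\<^sup>2) \<le> c\<^sup>2"
    using assms l2_bound_iff_sum[OF l2_bound_nonneg[OF assms]]
    by (intro infsum_le_finite_sums l2_bound_summable) auto
  then show ?thesis
    unfolding ell2_norm_def using l2_bound_nonneg[OF assms] by (intro real_le_lsqrt)
qed

lemma ell2_iff: "v \<in> ell2 A \<longleftrightarrow> (\<forall>\<gamma>. \<gamma> \<notin> A \<longrightarrow> v \<gamma> = 0) \<and> (\<exists>c. l2_bound A c v)"
  unfolding ell2_def using l2_bound_summable l2_bound_ell2_norm by blast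

lemma ell2_l2_bound: "v \<in> ell2 A \<Longrightarrow> l2_bound A (ell2_norm A v) v"
  by (simp add: ell2_def l2_bound_ell2_norm)

lemma restr_ell2: "l2_bound A c v \<Longrightarrow> restr A v \<in> ell2 A"
  unfolding ell2_iff using l2_bound_cong[of A v "restr A v" c] by (auto simp: restr_def)

text \<open>Cauchy-Schwarz on finite subsets bounds the partial sums of absolute values, which gives
  absolute summability and the estimate at once.\<close>

lemma l2_pairing:
  assumes "l2_bound A c v" "l2_bound A d w"
  shows "(\<lambda>\<gamma>. cnj (v \<gamma>) * w \<gamma>) summable_on A"
    and "cmod (\<Sum>\<^sub>\<infinity>\<gamma>\<in>A. cnj (v \<gamma>) * w \<gamma>) \<le> c * d"
proof -
  have le: "(\<Sum>\<gamma>\<in>F. norm (cnj (v \<gamma>) * w \<gamma>)) \<le> c * d" if F: "finite F" "F \<subseteq> A" for F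
  proof -
    have "(\<Sum>\<gamma>\<in>F. norm (cnj (v \<gamma>) * w \<gamma>)) = (\<Sum>\<gamma>\<in>F. \<bar>cmod (v \<gamma>)\<bar> * \<bar>cmod (w \<gamma>)\<bar>)"
      by (simp add: norm_mult)
    also have "\<dots> \<le> L2_set (\<lambda>\<gamma>. cmod (v \<gamma>)) F * L2_set (\<lambda>\<gamma>. cmod (w \<gamma>)) F"
      by (rule L2_set_mult_ineq)
    also have "\<dots> \<le> c * d"
      using assms F by (intro mult_mono l2_boundD) (auto dest: l2_bound_nonneg)
    finally show ?thesis .
  qed
  have abs: "(\<lambda>\<gamma>. norm (cnj (v \<gamma>) * w \<gamma>)) summable_on A"
    using le by (intro nonneg_bdd_above_summable_on bdd_aboveI2[where M = "c * d"]) auto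
  then show "(\<lambda>\<gamma>. cnj (v \<gamma>) * w \<gamma>) summable_on A"
    by (rule abs_summable_summable)
  have "cmod (\<Sum>\<^sub>\<infinity>\<gamma>\<in>A. cnj (v \<gamma>) * w \<gamma>) \<le> (\<Sum>\<^sub>\<infinity>\<gamma>\<in>A. norm (cnj (v \<gamma>) * w \<gamma>))"
    using abs by (rule norm_infsum_bound)
  also have "\<dots> \<le> c * d"
    using abs le by (intro infsum_le_finite_sums) auto
  finally show "cmod (\<Sum>\<^sub>\<infinity>\<gamma>\<in>A. cnj (v \<gamma>) * w \<gamma>) \<le> c * d" .
qed

section \<open>Uniform bounds on fibres\<close>

text \<open>Stands for \<open>L2_norm G \<xi> \<le> c\<close>, but remains meaningful before the
  supremum in \<open>L2_norm\<close> is known to be finite. Points \<open>x\<close> outside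
  \<open>units G\<close> have empty fibres and ask only for \<open>0 \<le> c\<close>.\<close>

definition fibre_bound :: "'g groupoid_ops \<Rightarrow> real \<Rightarrow> ('g \<Rightarrow> complex) \<Rightarrow> bool" where
  "fibre_bound G c \<xi> \<longleftrightarrow> (\<forall>x. l2_bound (fibre G x) c \<xi>)"

lemma fibre_boundD: "fibre_bound G c \<xi> \<Longrightarrow> l2_bound (fibre G x) c \<xi>"
  by (simp add: fibre_bound_def)

lemma fibre_bound_nonneg: "fibre_bound G c \<xi> \<Longrightarrow> 0 \<le> c"
  by (rule l2_bound_nonneg[OF fibre_boundD])

lemma fibre_bound_point: "fibre_bound G c \<xi> \<Longrightarrow> cmod (\<xi> \<gamma>) \<le> c"
  using l2_bound_point[OF fibre_boundD, of G c \<xi> \<gamma> "src G \<gamma>"] by (simp add: fibre_def)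

lemma fibre_bound_mono: "fibre_bound G c \<xi> \<Longrightarrow> c \<le> d \<Longrightarrow> fibre_bound G d \<xi>"
  by (meson fibre_bound_def l2_bound_mono)

lemma fibre_bound_dominated:
  "fibre_bound G c \<xi> \<Longrightarrow> 0 \<le> M \<Longrightarrow> (\<And>\<gamma>. cmod (\<eta> \<gamma>) \<le> M * cmod (\<xi> \<gamma>)) \<Longrightarrow> fibre_bound G (M * c) \<eta>"
  unfolding fibre_bound_def by (blast intro: l2_bound_dominated)

lemma fibre_bound_scale: "fibre_bound G c \<xi> \<Longrightarrow> fibre_bound G (cmod a * c) (\<lambda>\<gamma>. a * \<xi> \<gamma>)"
  by (simp add: fibre_bound_def l2_bound_scale)

lemma fibre_bound_add:
  "fibre_bound G c \<xi> \<Longrightarrow> fibre_bound G d \<eta> \<Longrightarrow> fibre_bound G (c + d) (\<lambda>\<gamma>. \<xi> \<gamma> + \<eta> \<gamma>)"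
  by (simp add: fibre_bound_def l2_bound_add)

lemma fibre_bound_diff:
  "fibre_bound G c \<xi> \<Longrightarrow> fibre_bound G d \<eta> \<Longrightarrow> fibre_bound G (c + d) (\<lambda>\<gamma>. \<xi> \<gamma> - \<eta> \<gamma>)"
  by (simp add: fibre_bound_def l2_bound_diff)

lemma fibre_bound_limit:
  assumes "\<And>\<gamma>. ((\<lambda>i. \<xi> i \<gamma>) \<longlongrightarrow> \<eta> \<gamma>) F" "F \<noteq> bot" "\<forall>\<^sub>F i in F. fibre_bound G c (\<xi> i)"
  shows "fibre_bound G c \<eta>"
  unfolding fibre_bound_def
proof
  fix x
  have "\<forall>\<^sub>F i in F. l2_bound (fibre G x) c (\<xi> i)"
    using assms(3) by eventually_elim (rule fibre_boundD)
  then show "l2_bound (fibre G x) c \<eta>"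
    using assms(1,2) by (intro l2_bound_limit[where v = \<xi> and F = F])
qed

text \<open>Real parts of summable families are summable, so both sides are summable together;
  otherwise both take the default value 0.\<close>

lemma infsum_complex_of_real: "(\<Sum>\<^sub>\<infinity>\<gamma>\<in>A. complex_of_real (f \<gamma>)) = complex_of_real (infsum f A)"
proof (cases "f summable_on A")
  case True
  then show ?thesis
    by (intro infsumI) (simp add: has_sum_of_real_iff)
next
  case False
  moreover from this have "\<not> (\<lambda>\<gamma>. complex_of_real (f \<gamma>)) summable_on A"
    using summable_on_Re[of "\<lambda>\<gamma>. complex_of_real (f \<gamma>)" A] by auto
  ultimately show ?thesis
    by (simp add: infsum_not_exists)
qed

lemma L2_inner_self: "L2_inner G \<xi> \<xi> x = complex_of_real ((ell2_norm (fibre G x) \<xi>)\<^sup>2)"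
proof -
  have "L2_inner G \<xi> \<xi> x = (\<Sum>\<^sub>\<infinity>\<gamma>\<in>fibre G x. complex_of_real ((cmod (\<xi> \<gamma>))\<^sup>2))"
    unfolding L2_inner_def
    by (intro infsum_cong) (metis complex_norm_square mult.commute of_real_power)
  also have "\<dots> = complex_of_real (\<Sum>\<^sub>\<infinity>\<gamma>\<in>fibre G x. (cmod (\<xi> \<gamma>))\<^sup>2)"
    by (rule infsum_complex_of_real)
  finally show ?thesis
    by (simp add: ell2_norm_def infsum_nonneg)
qed

lemma ell2_norm_nonneg: "0 \<le> ell2_norm A v"
  by (simp add: ell2_norm_def infsum_nonneg)

lemma L2_inner_self_le:
  assumes "fibre_bound G c \<xi>"
  shows "cmod (L2_inner G \<xi> \<xi> x) \<le> c\<^sup>2"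
proof -
  have "(ell2_norm (fibre G x) \<xi>)\<^sup>2 \<le> c\<^sup>2"
    by (rule power_mono[OF ell2_norm_le[OF fibre_boundD[OF assms]] ell2_norm_nonneg])
  then show ?thesis
    by (simp add: L2_inner_self norm_power del: of_real_power)
qed

lemma units_nonempty: "units G \<noteq> {}"
  by (simp add: units_def)

lemma L2_norm_le:
  assumes "fibre_bound G c \<xi>"
  shows "L2_norm G \<xi> \<le> c"
proof -
  have "(SUP x\<in>units G. cmod (L2_inner G \<xi> \<xi> x)) \<le> c\<^sup>2"
    by (rule cSUP_least[OF units_nonempty L2_inner_self_le[OF assms]])
  then show ?thesis
    unfolding L2_norm_def by (rule real_le_lsqrt[OF fibre_bound_nonneg[OF assms]])
qed

text \<open>The given bound \<open>c\<close> serves only to make the fibre sums converge and their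
  supremum exist; the supremum is then itself a bound.\<close>

lemma fibre_bound_L2_norm:
  assumes "fibre_bound G c \<xi>"
  shows "fibre_bound G (L2_norm G \<xi>) \<xi>"
proof -
  have bdd: "bdd_above ((\<lambda>x. cmod (L2_inner G \<xi> \<xi> x)) ` units G)"
    by (rule bdd_aboveI2[OF L2_inner_self_le[OF assms]])
  \<comment> \<open>Settles the points that are not units, whose fibres are empty.\<close>
  have nonneg: "0 \<le> L2_norm G \<xi>"
  proof -
    obtain x where "x \<in> units G" using units_nonempty[of G] by blast
    then have "0 \<le> (SUP x\<in>units G. cmod (L2_inner G \<xi> \<xi> x))"
      using bdd by (intro cSUP_upper2) auto
    then show ?thesis by (simp add: L2_norm_def)
  qed
  have "l2_bound (fibre G x) (L2_norm G \<xi>) \<xi>" for x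
  proof (cases "x \<in> units G")
    case True
    have "(ell2_norm (fibre G x) \<xi>)\<^sup>2 \<le> (SUP x\<in>units G. cmod (L2_inner G \<xi> \<xi> x))"
      using cSUP_upper[OF True bdd] by (simp add: L2_inner_self norm_power del: of_real_power)
    then have "ell2_norm (fibre G x) \<xi> \<le> L2_norm G \<xi>"
      unfolding L2_norm_def by (rule real_le_rsqrt)
    then show ?thesis
      using l2_bound_mono l2_bound_ell2_norm[OF l2_bound_summable[OF fibre_boundD[OF assms]]] by blast
  next
    case False
    then have "fibre G x = {}" by (auto simp: fibre_def units_def)
    then show ?thesis using nonneg by (simp add: l2_bound_def)
  qed
  then show ?thesis by (simp add: fibre_bound_def)
qed

lemma L2_inner_bound:
  "fibre_bound G c \<xi> \<Longrightarrow> fibre_bound G d \<eta> \<Longrightarrow> cmod (L2_inner G \<xi> \<eta> x) \<le> c * d"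
  unfolding L2_inner_def by (rule l2_pairing) (erule fibre_boundD)+

lemma L2_inner_cnj: "L2_inner G \<eta> \<xi> x = cnj (L2_inner G \<xi> \<eta> x)"
proof -
  have "cnj (L2_inner G \<xi> \<eta> x) = (\<Sum>\<^sub>\<infinity>\<gamma>\<in>fibre G x. cnj (cnj (\<xi> \<gamma>) * \<eta> \<gamma>))"
    unfolding L2_inner_def by (rule infsum_cnj[symmetric])
  then show ?thesis
    unfolding L2_inner_def by (simp add: mult.commute)
qed

lemma L2_inner_cong:
  "(\<And>\<gamma>. \<gamma> \<in> fibre G x \<Longrightarrow> \<xi> \<gamma> = \<xi>' \<gamma>) \<Longrightarrow> L2_inner G \<eta> \<xi> x = L2_inner G \<eta> \<xi>' x"
  unfolding L2_inner_def by (intro infsum_cong) simp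

lemma L2_inner_scale: "L2_inner G \<eta> (\<lambda>\<gamma>. a * \<xi> \<gamma>) x = a * L2_inner G \<eta> \<xi> x"
  unfolding L2_inner_def by (subst infsum_cmult_right'[symmetric]) (simp add: mult.left_commute)

lemma L2_inner_add:
  assumes "l2_bound (fibre G x) b \<eta>" "l2_bound (fibre G x) c \<xi>" "l2_bound (fibre G x) d \<zeta>"
  shows "L2_inner G \<eta> (\<lambda>\<gamma>. \<xi> \<gamma> + \<zeta> \<gamma>) x = L2_inner G \<eta> \<xi> x + L2_inner G \<eta> \<zeta> x"
  unfolding L2_inner_def
  using infsum_add[OF l2_pairing(1)[OF assms(1,2)] l2_pairing(1)[OF assms(1,3)]]
  by (simp add: distrib_left)

section \<open>Bisections and functions of compact support\<close>

lemma compact_closure_subset: "compact C \<Longrightarrow> closure S \<subseteq> C \<Longrightarrow> compact (closure S)"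
  using compact_Int_closed[of C "closure S"] by (simp add: inf.absorb2)

lemma finite_disjoint_neighbourhoods:
  fixes F :: "'a::t2_space set"
  assumes "finite F"
  obtains N where "\<And>\<gamma>. \<gamma> \<in> F \<Longrightarrow> open (N \<gamma>)" "\<And>\<gamma>. \<gamma> \<in> F \<Longrightarrow> \<gamma> \<in> N \<gamma>"
    "\<And>\<gamma> \<delta>. \<gamma> \<in> F \<Longrightarrow> \<delta> \<in> F \<Longrightarrow> \<gamma> \<noteq> \<delta> \<Longrightarrow> N \<gamma> \<inter> N \<delta> = {}"
proof -
  have "\<forall>\<gamma> \<delta> :: 'a. \<exists>U V. \<gamma> \<noteq> \<delta> \<longrightarrow> open U \<and> open V \<and> \<gamma> \<in> U \<and> \<delta> \<in> V \<and> U \<inter> V = {}"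
    using hausdorff by metis
  then obtain U V :: "'a \<Rightarrow> 'a \<Rightarrow> 'a set" where
    UV: "\<And>\<gamma> \<delta>. \<gamma> \<noteq> \<delta> \<Longrightarrow> open (U \<gamma> \<delta>) \<and> open (V \<gamma> \<delta>) \<and> \<gamma> \<in> U \<gamma> \<delta> \<and> \<delta> \<in> V \<gamma> \<delta> \<and> U \<gamma> \<delta> \<inter> V \<gamma> \<delta> = {}"
    by metis
  \<comment> \<open>The separating sets belong to ordered pairs, so each point takes its first set
    against every \<open>\<delta>\<close> and its second set from every \<open>\<delta>\<close>;
    disjointness for either order then comes from a single pair.\<close>
  let ?N = "\<lambda>\<gamma>. \<Inter>\<delta>\<in>F - {\<gamma>}. U \<gamma> \<delta> \<inter> V \<delta> \<gamma>"
  show ?thesis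
  proof
    show "open (?N \<gamma>)" if "\<gamma> \<in> F" for \<gamma>
      using assms by (intro open_INT) (auto simp: UV intro!: open_Int)
    show "\<gamma> \<in> ?N \<gamma>" if "\<gamma> \<in> F" for \<gamma>
    proof
      fix \<delta> assume "\<delta> \<in> F - {\<gamma>}"
      then show "\<gamma> \<in> U \<gamma> \<delta> \<inter> V \<delta> \<gamma>"
        using UV[of \<gamma> \<delta>] UV[of \<delta> \<gamma>] by auto
    qed
    show "?N \<gamma> \<inter> ?N \<delta> = {}" if "\<gamma> \<in> F" "\<delta> \<in> F" "\<gamma> \<noteq> \<delta>" for \<gamma> \<delta>
    proof -
      have "?N \<gamma> \<subseteq> U \<gamma> \<delta>" "?N \<delta> \<subseteq> V \<gamma> \<delta>" using that by auto
      then show ?thesis using UV[OF that(3)] by blast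
    qed
  qed
qed

text \<open>Local compactness puts a compact closed \<open>C\<close> with \<open>\<gamma>\<close> in
  its interior inside \<open>W\<close>, and locally compact Hausdorff spaces are completely regular.
  A function that is 0 at \<open>\<gamma>\<close> and 1 off an open part of \<open>C\<close> is then
  subtracted from 1.\<close>

lemma Urysohn_compact_support:
  fixes W :: "'a::t2_space set"
  assumes locally_compact: "locally_compact_space (euclidean :: 'a topology)"
    and W: "open W" "\<gamma> \<in> W"
  obtains f :: "'a \<Rightarrow> real" where "continuous_on UNIV f" "\<And>\<alpha>. 0 \<le> f \<alpha>" "\<And>\<alpha>. f \<alpha> \<le> 1" "f \<gamma> = 1"
    "compact (closure {\<alpha>. f \<alpha> \<noteq> 0})" "closure {\<alpha>. f \<alpha> \<noteq> 0} \<subseteq> W"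
proof -
  have haus: "Hausdorff_space (euclidean :: 'a topology)"
    by (simp add: Hausdorff_space_def) (metis disjnt_def hausdorff)
  have "neighbourhood_base_of (\<lambda>C. compactin euclidean C \<and> closedin euclidean C) (euclidean :: 'a topology)"
    using locally_compact haus locally_compact_space_neighbourhood_base_closedin by blast
  then have "openin euclidean W \<and> \<gamma> \<in> W \<longrightarrow> (\<exists>U C. openin euclidean U \<and>
      (compactin euclidean C \<and> closedin euclidean C) \<and> \<gamma> \<in> U \<and> U \<subseteq> C \<and> C \<subseteq> W)"
    unfolding neighbourhood_base_of by (elim allE)
  then obtain U C where UC: "open U" "compact C" "closed C" "\<gamma> \<in> U" "U \<subseteq> C" "C \<subseteq> W"
    using W by (auto simp: open_openin[symmetric] closed_closedin[symmetric])
  have "completely_regular_space (euclidean :: 'a topology)"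
    using locally_compact haus locally_compact_regular_imp_completely_regular_space by blast
  then obtain h :: "'a \<Rightarrow> real" where h: "continuous_map euclidean (top_of_set {0..1}) h" "h \<gamma> = 0" "h ` (- U) \<subseteq> {1}"
    unfolding completely_regular_space_def closed_closedin[symmetric] topspace_euclidean
    using UC(1,4) by (meson ComplD DiffI UNIV_I closed_Compl)
  let ?f = "\<lambda>\<alpha>. 1 - h \<alpha>"
  have cont: "continuous_on UNIV h" and range: "\<And>\<alpha>. h \<alpha> \<in> {0..1}"
    using h(1) by (auto simp: continuous_map_in_subtopology)
  have "{\<alpha>. ?f \<alpha> \<noteq> 0} \<subseteq> C"
    using h(3) UC by auto
  then have cl: "closure {\<alpha>. ?f \<alpha> \<noteq> 0} \<subseteq> C"
    using UC(3) by (rule closure_minimal)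
  show ?thesis
  proof
    show "continuous_on UNIV ?f" by (intro continuous_intros cont)
    show "0 \<le> ?f \<alpha>" "?f \<alpha> \<le> 1" for \<alpha> using range[of \<alpha>] by auto
    show "?f \<gamma> = 1" using h by simp
    show "closure {\<alpha>. ?f \<alpha> \<noteq> 0} \<subseteq> W" using cl UC by blast
    show "compact (closure {\<alpha>. ?f \<alpha> \<noteq> 0})"
      by (rule compact_closure_subset[OF UC(2) cl])
  qed
qed

section \<open>Stability of compactly supported functions\<close>

lemma Cc_diff: "\<xi> \<in> Cc \<Longrightarrow> \<eta> \<in> Cc \<Longrightarrow> (\<lambda>\<gamma>. \<xi> \<gamma> - \<eta> \<gamma>) \<in> Cc"
proof -
  assume *: "\<xi> \<in> Cc" "\<eta> \<in> Cc"
  have "{\<gamma>. \<xi> \<gamma> - \<eta> \<gamma> \<noteq> 0} \<subseteq> {\<gamma>. \<xi> \<gamma> \<noteq> 0} \<union> {\<gamma>. \<eta> \<gamma> \<noteq> 0}" by auto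
  then have "closure {\<gamma>. \<xi> \<gamma> - \<eta> \<gamma> \<noteq> 0} \<subseteq> closure {\<gamma>. \<xi> \<gamma> \<noteq> 0} \<union> closure {\<gamma>. \<eta> \<gamma> \<noteq> 0}"
    by (metis closure_Un closure_mono)
  moreover have "compact (closure {\<gamma>. \<xi> \<gamma> \<noteq> 0} \<union> closure {\<gamma>. \<eta> \<gamma> \<noteq> 0})"
    using * by (auto simp: Cc_def)
  ultimately have "compact (closure {\<gamma>. \<xi> \<gamma> - \<eta> \<gamma> \<noteq> 0})"
    by (rule compact_closure_subset[rotated])
  then show ?thesis using * by (auto simp: Cc_def intro!: continuous_intros)
qed

lemma Cc_mult:
  assumes "\<xi> \<in> Cc" "continuous_on UNIV f"
  shows "(\<lambda>\<gamma>. f \<gamma> * \<xi> \<gamma>) \<in> Cc"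
proof -
  have "closure {\<gamma>. f \<gamma> * \<xi> \<gamma> \<noteq> 0} \<subseteq> closure {\<gamma>. \<xi> \<gamma> \<noteq> 0}"
    by (rule closure_mono) auto
  moreover have "compact (closure {\<gamma>. \<xi> \<gamma> \<noteq> 0})"
    using assms by (auto simp: Cc_def)
  ultimately have "compact (closure {\<gamma>. f \<gamma> * \<xi> \<gamma> \<noteq> 0})"
    by (rule compact_closure_subset[rotated])
  then show ?thesis using assms by (auto simp: Cc_def intro!: continuous_intros)
qed

section \<open>Fibres, and separation expressed by quotients\<close>

lemma fibre_src [simp]: "\<gamma> \<in> fibre G (src G \<gamma>)"
  by (simp add: fibre_def)

lemma fibre_iff: "\<gamma> \<in> fibre G x \<longleftrightarrow> src G \<gamma> = x"
  by (simp add: fibre_def)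

text \<open>The equation \<open>\<alpha> = mul G k \<beta>\<close> has exactly one solution
  \<open>k\<close>, the quotient of \<open>\<alpha>\<close> by \<open>\<beta>\<close>.\<close>

lemma (in groupoid) mul_in_set_mul_iff:
  assumes "src G \<alpha> = src G \<beta>"
  shows "\<alpha> \<in> set_mul G K {\<beta>} \<longleftrightarrow> mul G \<alpha> (ginv G \<beta>) \<in> K"
proof
  assume "\<alpha> \<in> set_mul G K {\<beta>}"
  then obtain k where k: "k \<in> K" "src G k = rng G \<beta>" "\<alpha> = mul G k \<beta>"
    by (auto simp: set_mul_def)
  then have "mul G \<alpha> (ginv G \<beta>) = mul G k (mul G \<beta> (ginv G \<beta>))"
    by (simp add: mul_assoc rng_ginv)
  also have "\<dots> = k"
    using k mul_src_right[of k] by (simp add: mul_ginv)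
  finally show "mul G \<alpha> (ginv G \<beta>) \<in> K"
    using k by simp
next
  assume K: "mul G \<alpha> (ginv G \<beta>) \<in> K"
  have "mul G (mul G \<alpha> (ginv G \<beta>)) \<beta> = mul G \<alpha> (mul G (ginv G \<beta>) \<beta>)"
    using assms by (intro mul_assoc) (simp_all add: rng_ginv src_ginv)
  also have "\<dots> = \<alpha>"
    using assms mul_src_right[of \<alpha>] by (simp add: ginv_mul)
  finally have "\<alpha> = mul G (mul G \<alpha> (ginv G \<beta>)) \<beta>" by simp
  moreover have "src G (mul G \<alpha> (ginv G \<beta>)) = rng G \<beta>"
    using assms by (simp add: src_mul rng_ginv src_ginv)
  ultimately show "\<alpha> \<in> set_mul G K {\<beta>}"
    using K unfolding set_mul_def by blast
qed

text \<open>A product has the source of its right factor, so only pairs in a common fibre can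
  collide. In this form separation is a condition on a continuous function of the pair.\<close>

lemma (in groupoid) set_mul_disjoint_iff:
  "set_mul G K B \<inter> A = {} \<longleftrightarrow>
     (\<forall>\<alpha>\<in>A. \<forall>\<beta>\<in>B. src G \<alpha> = src G \<beta> \<longrightarrow> mul G \<alpha> (ginv G \<beta>) \<notin> K)"
proof -
  have "\<alpha> \<in> set_mul G K B \<longleftrightarrow> (\<exists>\<beta>\<in>B. src G \<alpha> = src G \<beta> \<and> \<alpha> \<in> set_mul G K {\<beta>})" for \<alpha>
    unfolding set_mul_def using src_mul by blast
  then show ?thesis
    using mul_in_set_mul_iff by blast
qed

lemma (in groupoid) ginv_ginv: "ginv G (ginv G \<alpha>) = \<alpha>"
proof -
  have "ginv G (ginv G \<alpha>) = mul G (ginv G (ginv G \<alpha>)) (mul G (ginv G \<alpha>) \<alpha>)"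
    using mul_src_right[of "ginv G (ginv G \<alpha>)"] by (simp add: ginv_mul src_ginv rng_ginv)
  also have "\<dots> = mul G (mul G (ginv G (ginv G \<alpha>)) (ginv G \<alpha>)) \<alpha>"
    by (intro mul_assoc[symmetric]) (simp_all add: src_ginv)
  also have "\<dots> = \<alpha>"
    by (simp add: ginv_mul src_ginv rng_mul_left)
  finally show ?thesis .
qed

section \<open>Open bisections, lifts from fibres, and the module \<open>L2 G\<close>\<close>

context lc_etale_groupoid
begin

lemma rng_locally_injective: "\<exists>U. open U \<and> \<gamma> \<in> U \<and> inj_on (rng G) U"
proof -
  obtain U h where "open U" "\<gamma> \<in> U" "homeomorphism U (rng G ` U) (rng G) h"
    using etale unfolding local_homeomorphism_def subtopology_UNIV open_openin[symmetric] by blast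
  then show ?thesis
    by (metis homeomorphism_def inj_on_inverseI)
qed

text \<open>Inversion exchanges source and range, so a set on which the range is injective is pulled
  back along it.\<close>

lemma src_locally_injective: "\<exists>U. open U \<and> \<gamma> \<in> U \<and> inj_on (src G) U"
proof -
  obtain U where U: "open U" "ginv G \<gamma> \<in> U" "inj_on (rng G) U"
    using rng_locally_injective by blast
  have "open (ginv G -` U)"
    using U continuous_ginv by (simp add: open_vimage)
  moreover have "inj_on (src G) (ginv G -` U)"
  proof (rule inj_onI)
    fix \<alpha> \<beta> assume "\<alpha> \<in> ginv G -` U" "\<beta> \<in> ginv G -` U" "src G \<alpha> = src G \<beta>"
    then have "ginv G \<alpha> = ginv G \<beta>"
      using U(3) by (simp add: inj_on_def rng_ginv)
    then show "\<alpha> = \<beta>" by (metis ginv_ginv)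
  qed
  ultimately show ?thesis using U by blast
qed

text \<open>The quotient is continuous relative to the pairs with equal sources, and the complement
  of \<open>K\<close> is open. A box around \<open>(\<alpha>, \<beta>)\<close> therefore controls
  exactly those of its pairs that lie in a common fibre.\<close>

lemma quotient_avoids_closed:
  assumes "closed K" "src G \<alpha> = src G \<beta>" "mul G \<alpha> (ginv G \<beta>) \<notin> K"
  obtains U V where "open U" "open V" "\<alpha> \<in> U" "\<beta> \<in> V"
    "\<And>u v. u \<in> U \<Longrightarrow> v \<in> V \<Longrightarrow> src G u = src G v \<Longrightarrow> mul G u (ginv G v) \<notin> K"
proof -
  let ?D = "{(u, v). src G u = src G v}"
  have "continuous_on ?D (\<lambda>p. (fst p, ginv G (snd p)))"
    by (intro continuous_intros continuous_on_compose2[OF continuous_ginv]) auto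
  then have "continuous_on ?D (\<lambda>p. (\<lambda>(\<alpha>, \<beta>). mul G \<alpha> \<beta>) (fst p, ginv G (snd p)))"
    by (rule continuous_on_compose2[OF continuous_mul])
      (auto simp: composable_def rng_ginv)
  then have "\<forall>p\<in>?D. \<forall>B. open B \<longrightarrow> mul G (fst p) (ginv G (snd p)) \<in> B \<longrightarrow>
      (\<exists>W. open W \<and> p \<in> W \<and> (\<forall>q\<in>?D. q \<in> W \<longrightarrow> mul G (fst q) (ginv G (snd q)) \<in> B))"
    unfolding continuous_on_topological by (simp only: prod.case)
  moreover have "(\<alpha>, \<beta>) \<in> ?D" "open (- K)" "mul G (fst (\<alpha>, \<beta>)) (ginv G (snd (\<alpha>, \<beta>))) \<in> - K"
    using assms by (auto simp: open_Compl)
  ultimately obtain W where W: "open W" "(\<alpha>, \<beta>) \<in> W"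
    "\<forall>q\<in>?D. q \<in> W \<longrightarrow> mul G (fst q) (ginv G (snd q)) \<in> - K"
    by blast
  obtain U V where "open U" "open V" "(\<alpha>, \<beta>) \<in> U \<times> V" "U \<times> V \<subseteq> W"
    using open_prod_elim[OF W(1,2)] by metis
  then show ?thesis
    using that[of U V] W(3) by fastforce
qed

text \<open>The lift is a combination, with coefficients from \<open>v\<close>, of bump functions on
  disjoint open bisections around the points of \<open>F\<close>. Any fibre meets each bisection at
  most once, so on every fibre, not only over \<open>x\<close>, the values are dominated by distinct
  values of \<open>v\<close>.\<close>

lemma Cc_lift:
  assumes "finite F" "F \<subseteq> fibre G x" "open W" "F \<subseteq> W"
  shows "\<exists>\<eta>\<in>Cc. (\<forall>\<gamma>\<in>fibre G x. \<eta> \<gamma> = restr F v \<gamma>) \<and> closure {\<gamma>. \<eta> \<gamma> \<noteq> 0} \<subseteq> W \<and>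
    fibre_bound G (L2_set (\<lambda>\<gamma>. cmod (v \<gamma>)) F) \<eta> \<and>
    (\<forall>M\<ge>0. (\<forall>\<gamma>\<in>F. cmod (v \<gamma>) \<le> M) \<longrightarrow> (\<forall>\<gamma>. cmod (\<eta> \<gamma>) \<le> M))"
proof -
  obtain N where N: "\<And>\<gamma>. \<gamma> \<in> F \<Longrightarrow> open (N \<gamma>)" "\<And>\<gamma>. \<gamma> \<in> F \<Longrightarrow> \<gamma> \<in> N \<gamma>"
    "\<And>\<gamma> \<delta>. \<gamma> \<in> F \<Longrightarrow> \<delta> \<in> F \<Longrightarrow> \<gamma> \<noteq> \<delta> \<Longrightarrow> N \<gamma> \<inter> N \<delta> = {}"
    using finite_disjoint_neighbourhoods[OF assms(1)] by blast
  obtain I where I: "\<And>\<gamma>. open (I \<gamma>) \<and> \<gamma> \<in> I \<gamma> \<and> inj_on (src G) (I \<gamma>)"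
    using src_locally_injective by metis
  \<comment> \<open>\<open>N\<close> makes the sets disjoint, \<open>I\<close> makes the source
    injective on each, and \<open>W\<close> confines the support.\<close>
  define P where "P \<gamma> = N \<gamma> \<inter> I \<gamma> \<inter> W" for \<gamma>
  have P: "open (P \<gamma>)" "\<gamma> \<in> P \<gamma>" "inj_on (src G) (P \<gamma>)" "P \<gamma> \<subseteq> W" if "\<gamma> \<in> F" for \<gamma>
    using that N(1,2)[OF that] I[of \<gamma>] assms unfolding P_def
    by (auto intro: inj_on_subset[of "src G" "I \<gamma>"])
  have disj: "P \<gamma> \<inter> P \<delta> = {}" if "\<gamma> \<in> F" "\<delta> \<in> F" "\<gamma> \<noteq> \<delta>" for \<gamma> \<delta>
    using N(3)[OF that] by (auto simp: P_def)
  have "\<forall>\<gamma>\<in>F. \<exists>f :: 'g \<Rightarrow> real. continuous_on UNIV f \<and> (\<forall>\<alpha>. 0 \<le> f \<alpha> \<and> f \<alpha> \<le> 1) \<and> f \<gamma> = 1 \<and>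
     compact (closure {\<alpha>. f \<alpha> \<noteq> 0}) \<and> closure {\<alpha>. f \<alpha> \<noteq> 0} \<subseteq> P \<gamma>"
  proof
    fix \<gamma> assume "\<gamma> \<in> F"
    then have "open (P \<gamma>)" "\<gamma> \<in> P \<gamma>" by (rule P)+
    then show "\<exists>f :: 'g \<Rightarrow> real. continuous_on UNIV f \<and> (\<forall>\<alpha>. 0 \<le> f \<alpha> \<and> f \<alpha> \<le> 1) \<and> f \<gamma> = 1 \<and>
        compact (closure {\<alpha>. f \<alpha> \<noteq> 0}) \<and> closure {\<alpha>. f \<alpha> \<noteq> 0} \<subseteq> P \<gamma>"
      by (rule Urysohn_compact_support[OF locally_compact]) (intro exI conjI allI)
  qed
  from bchoice[OF this] obtain f :: "'g \<Rightarrow> 'g \<Rightarrow> real" where f': "\<forall>\<gamma>\<in>F. continuous_on UNIV (f \<gamma>) \<and>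
      (\<forall>\<alpha>. 0 \<le> f \<gamma> \<alpha> \<and> f \<gamma> \<alpha> \<le> 1) \<and> f \<gamma> \<gamma> = 1 \<and>
      compact (closure {\<alpha>. f \<gamma> \<alpha> \<noteq> 0}) \<and> closure {\<alpha>. f \<gamma> \<alpha> \<noteq> 0} \<subseteq> P \<gamma>" ..
  have f: "continuous_on UNIV (f \<gamma>)" "0 \<le> f \<gamma> \<alpha> \<and> f \<gamma> \<alpha> \<le> 1" "f \<gamma> \<gamma> = 1"
      "compact (closure {\<alpha>. f \<gamma> \<alpha> \<noteq> 0})" "closure {\<alpha>. f \<gamma> \<alpha> \<noteq> 0} \<subseteq> P \<gamma>"
    if "\<gamma> \<in> F" for \<gamma> \<alpha>
    using bspec[OF f' that] by simp_all
  have f0: "f \<gamma> \<alpha> = 0" if "\<gamma> \<in> F" "\<alpha> \<notin> P \<gamma>" for \<gamma> \<alpha>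
    using subset_trans[OF closure_subset f(5)[OF that(1)]] that(2) by auto
  define \<eta> where "\<eta> \<alpha> = (\<Sum>\<gamma>\<in>F. v \<gamma> * complex_of_real (f \<gamma> \<alpha>))" for \<alpha>
  have \<eta>_in: "\<eta> \<alpha> = v \<gamma> * complex_of_real (f \<gamma> \<alpha>)" if "\<gamma> \<in> F" "\<alpha> \<in> P \<gamma>" for \<alpha> \<gamma>
  proof -
    have "\<eta> \<alpha> = (\<Sum>\<delta>\<in>F. if \<delta> = \<gamma> then v \<gamma> * complex_of_real (f \<gamma> \<alpha>) else 0)"
      unfolding \<eta>_def
    proof (rule sum.cong[OF refl])
      fix \<delta> assume "\<delta> \<in> F"
      then show "v \<delta> * complex_of_real (f \<delta> \<alpha>) = (if \<delta> = \<gamma> then v \<gamma> * complex_of_real (f \<gamma> \<alpha>) else 0)"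
        using f0[of \<delta> \<alpha>] disj[of \<gamma> \<delta>] that by auto
    qed
    then show ?thesis using assms(1) that by simp
  qed
  have \<eta>_out: "\<eta> \<alpha> = 0" if "\<And>\<gamma>. \<gamma> \<in> F \<Longrightarrow> \<alpha> \<notin> P \<gamma>" for \<alpha>
    unfolding \<eta>_def using that f0 by (intro sum.neutral) simp
  have \<eta>_le: "cmod (\<eta> \<alpha>) \<le> cmod (v \<gamma>)" if "\<gamma> \<in> F" "\<alpha> \<in> P \<gamma>" for \<alpha> \<gamma>
    using \<eta>_in[OF that] f(2)[OF that(1)] mult_left_le[of "f \<gamma> \<alpha>" "cmod (v \<gamma>)"] by (simp add: norm_mult)
  define C where "C = (\<Union>\<gamma>\<in>F. closure {\<alpha>. f \<gamma> \<alpha> \<noteq> 0})"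
  have "compact C" unfolding C_def using assms(1) f(4) by (intro compact_UN) auto
  have "{\<alpha>. \<eta> \<alpha> \<noteq> 0} \<subseteq> C"
  proof
    fix \<alpha> assume "\<alpha> \<in> {\<alpha>. \<eta> \<alpha> \<noteq> 0}"
    then obtain \<gamma> where "\<gamma> \<in> F" "f \<gamma> \<alpha> \<noteq> 0"
      unfolding \<eta>_def using sum.not_neutral_contains_not_neutral by force
    then show "\<alpha> \<in> C" unfolding C_def using closure_subset[of "{\<alpha>. f \<gamma> \<alpha> \<noteq> 0}"] by blast
  qed
  then have cl: "closure {\<alpha>. \<eta> \<alpha> \<noteq> 0} \<subseteq> C"
    using \<open>compact C\<close> by (intro closure_minimal compact_imp_closed)
  show ?thesis
  proof (intro bexI[of _ \<eta>] conjI ballI allI impI)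
    have "compact (closure {\<gamma>. \<eta> \<gamma> \<noteq> 0})"
      by (rule compact_closure_subset[OF \<open>compact C\<close> cl])
    moreover have "continuous_on UNIV \<eta>"
      unfolding \<eta>_def using f(1) by (intro continuous_intros) auto
    ultimately show "\<eta> \<in> Cc" by (simp add: Cc_def)
    show "closure {\<gamma>. \<eta> \<gamma> \<noteq> 0} \<subseteq> W"
      using cl f(5) P(4) unfolding C_def by blast
    show "\<eta> \<gamma> = restr F v \<gamma>" if "\<gamma> \<in> fibre G x" for \<gamma>
    proof (cases "\<gamma> \<in> F")
      case True
      then show ?thesis using \<eta>_in[OF True P(2)] f(3) by (simp add: restr_def)
    next
      case False
      \<comment> \<open>\<open>P \<delta>\<close> already contains \<open>\<delta>\<close> from this
        fibre, so it has no room for another point of it.\<close>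
      have "\<gamma> \<notin> P \<delta>" if "\<delta> \<in> F" for \<delta>
      proof
        assume "\<gamma> \<in> P \<delta>"
        moreover have "src G \<gamma> = src G \<delta>"
          using that \<open>\<gamma> \<in> fibre G x\<close> assms(2) by (auto simp: fibre_def)
        ultimately show False
          using P(2,3)[OF that] False that by (metis inj_onD)
      qed
      then show ?thesis using \<eta>_out False by (simp add: restr_def)
    qed
    show "cmod (\<eta> \<gamma>) \<le> M" if "0 \<le> M" "\<forall>\<gamma>\<in>F. cmod (v \<gamma>) \<le> M" for M \<gamma>
      using \<eta>_out[of \<gamma>] \<eta>_le[of _ \<gamma>] that by (metis norm_zero order_trans)
    show "fibre_bound G (L2_set (\<lambda>\<gamma>. cmod (v \<gamma>)) F) \<eta>"
      unfolding fibre_bound_def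
    proof (intro allI l2_boundI)
      fix y H assume H: "finite H" "H \<subseteq> fibre G y"
      \<comment> \<open>Only points in some bisection contribute. Sending each to the centre of its
        bisection is injective because \<open>H\<close> lies in one fibre, so the sum is compared
        with a sum over part of \<open>F\<close>.\<close>
      define H' where "H' = {\<alpha>\<in>H. \<exists>\<gamma>\<in>F. \<alpha> \<in> P \<gamma>}"
      define p where "p \<alpha> = (SOME \<gamma>. \<gamma> \<in> F \<and> \<alpha> \<in> P \<gamma>)" for \<alpha>
      have p: "p \<alpha> \<in> F" "\<alpha> \<in> P (p \<alpha>)" if "\<alpha> \<in> H'" for \<alpha>
        using someI_ex[of "\<lambda>\<gamma>. \<gamma> \<in> F \<and> \<alpha> \<in> P \<gamma>"] that unfolding p_def H'_def by auto
      have inj: "inj_on p H'"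
      proof (rule inj_onI)
        fix \<alpha> \<beta> assume *: "\<alpha> \<in> H'" "\<beta> \<in> H'" "p \<alpha> = p \<beta>"
        then have "src G \<alpha> = src G \<beta>" using H(2) by (auto simp: H'_def fibre_def)
        then show "\<alpha> = \<beta>" using p[OF *(1)] p[OF *(2)] *(3) P(3) by (metis inj_onD)
      qed
      have "(\<Sum>\<alpha>\<in>H. (cmod (\<eta> \<alpha>))\<^sup>2) = (\<Sum>\<alpha>\<in>H'. (cmod (\<eta> \<alpha>))\<^sup>2)"
        using H(1) \<eta>_out by (intro sum.mono_neutral_right) (auto simp: H'_def)
      also have "\<dots> \<le> (\<Sum>\<alpha>\<in>H'. (cmod (v (p \<alpha>)))\<^sup>2)"
        using p \<eta>_le by (intro sum_mono power_mono) auto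
      also have "\<dots> = (\<Sum>\<gamma>\<in>p ` H'. (cmod (v \<gamma>))\<^sup>2)"
        by (simp add: sum.reindex[OF inj])
      also have "\<dots> \<le> (\<Sum>\<gamma>\<in>F. (cmod (v \<gamma>))\<^sup>2)"
        using p assms(1) by (intro sum_mono2) auto
      finally show "L2_set (\<lambda>\<gamma>. cmod (\<eta> \<gamma>)) H \<le> L2_set (\<lambda>\<gamma>. cmod (v \<gamma>)) F"
        by (simp add: L2_set_def)
    qed
  qed
qed

text \<open>Finitely many open bisections cover \<open>C\<close>, and each contains at most one
  point of a given fibre; their number is the bound.\<close>

lemma compact_fibre_card:
  assumes "compact C"
  shows "\<exists>n. \<forall>x F. finite F \<and> F \<subseteq> fibre G x \<inter> C \<longrightarrow> card F \<le> n"
proof -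
  obtain I where I: "\<And>\<gamma>. open (I \<gamma>) \<and> \<gamma> \<in> I \<gamma> \<and> inj_on (src G) (I \<gamma>)"
    using src_locally_injective by metis
  obtain D where D: "finite D" "C \<subseteq> (\<Union>\<gamma>\<in>D. I \<gamma>)"
  proof (rule compactE_image[OF assms, of C I])
    show "open (I \<gamma>)" for \<gamma> using I by blast
    show "C \<subseteq> (\<Union>\<gamma>\<in>C. I \<gamma>)" using I by blast
  qed
  have "card F \<le> card D" if F: "finite F" "F \<subseteq> fibre G x \<inter> C" for x F
  proof -
    have "\<forall>\<alpha>\<in>F. \<exists>\<gamma>\<in>D. \<alpha> \<in> I \<gamma>" using F D by blast
    then obtain p where p: "\<forall>\<alpha>\<in>F. p \<alpha> \<in> D \<and> \<alpha> \<in> I (p \<alpha>)" by metis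
    have "inj_on p F"
    proof (rule inj_onI)
      fix \<alpha> \<beta> assume *: "\<alpha> \<in> F" "\<beta> \<in> F" "p \<alpha> = p \<beta>"
      then have "src G \<alpha> = src G \<beta>" using F by (auto simp: fibre_def)
      then show "\<alpha> = \<beta>" using I p * by (metis inj_onD)
    qed
    then show ?thesis using p D(1) by (intro card_inj_on_le[of p]) auto
  qed
  then show ?thesis by blast
qed

text \<open>A fibre meets the compact support in at most \<open>n\<close> points, with values at
  most \<open>M\<close>; the crude estimate of the l2 norm by the l1 norm then suffices.\<close>

lemma Cc_fibre_bound:
  assumes "\<xi> \<in> Cc"
  shows "\<exists>c. fibre_bound G c \<xi>"
proof -
  let ?C = "closure {\<gamma>. \<xi> \<gamma> \<noteq> 0}"
  have cont: "continuous_on UNIV \<xi>" and comp: "compact ?C"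
    using assms by (auto simp: Cc_def)
  obtain n where n: "\<forall>x F. finite F \<and> F \<subseteq> fibre G x \<inter> ?C \<longrightarrow> card F \<le> n"
    using compact_fibre_card[OF comp] ..
  have "bounded (\<xi> ` ?C)"
    using comp cont by (intro compact_imp_bounded compact_continuous_image continuous_on_subset[OF cont]) auto
  then obtain M where M: "M > 0" "\<And>\<gamma>. \<gamma> \<in> ?C \<Longrightarrow> cmod (\<xi> \<gamma>) \<le> M"
    by (auto simp: bounded_pos)
  have "L2_set (\<lambda>\<gamma>. cmod (\<xi> \<gamma>)) F \<le> real n * M" if F: "finite F" "F \<subseteq> fibre G x" for x F
  proof -
    have "L2_set (\<lambda>\<gamma>. cmod (\<xi> \<gamma>)) F \<le> (\<Sum>\<gamma>\<in>F. cmod (\<xi> \<gamma>))"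
      by (rule L2_set_le_sum) simp
    also have "\<dots> = (\<Sum>\<gamma>\<in>F \<inter> ?C. cmod (\<xi> \<gamma>))"
      using F(1) closure_subset[of "{\<gamma>. \<xi> \<gamma> \<noteq> 0}"] by (intro sum.mono_neutral_right) auto
    also have "\<dots> \<le> (\<Sum>\<gamma>\<in>F \<inter> ?C. M)"
      using M by (intro sum_mono) auto
    also have "\<dots> = real (card (F \<inter> ?C)) * M" by simp
    also have "\<dots> \<le> real n * M"
      using n[rule_format, of "F \<inter> ?C" x] F M(1) by (intro mult_right_mono) auto
    finally show ?thesis .
  qed
  then show ?thesis
    unfolding fibre_bound_def l2_bound_def by blast
qed

text \<open>Replaces Cauchy sequences by approximability in the uniform fibre norm. In one direction
  the Cauchy estimate passes to the pointwise limit; in the other, approximants with errors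
  \<open>1 / real (Suc n)\<close> form a Cauchy sequence with limit \<open>\<xi>\<close>.\<close>

lemma L2_iff: "\<xi> \<in> L2 G \<longleftrightarrow> (\<forall>\<epsilon>>0. \<exists>\<eta>\<in>Cc. fibre_bound G \<epsilon> (\<lambda>\<gamma>. \<xi> \<gamma> - \<eta> \<gamma>))"
proof
  assume "\<xi> \<in> L2 G"
  then obtain \<eta> where \<eta>: "\<And>n. \<eta> n \<in> Cc"
    "\<And>\<epsilon>. \<epsilon> > 0 \<Longrightarrow> \<exists>N. \<forall>m\<ge>N. \<forall>n\<ge>N. L2_norm G (\<lambda>\<gamma>. \<eta> m \<gamma> - \<eta> n \<gamma>) < \<epsilon>"
    "\<And>\<gamma>. (\<lambda>n. \<eta> n \<gamma>) \<longlonglongrightarrow> \<xi> \<gamma>"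
    unfolding L2_def by auto
  show "\<forall>\<epsilon>>0. \<exists>\<eta>\<in>Cc. fibre_bound G \<epsilon> (\<lambda>\<gamma>. \<xi> \<gamma> - \<eta> \<gamma>)"
  proof (intro allI impI)
    fix \<epsilon> :: real assume "\<epsilon> > 0"
    then obtain N where N: "\<And>m n. m \<ge> N \<Longrightarrow> n \<ge> N \<Longrightarrow> L2_norm G (\<lambda>\<gamma>. \<eta> m \<gamma> - \<eta> n \<gamma>) < \<epsilon>"
      using \<eta>(2) by metis
    have "fibre_bound G \<epsilon> (\<lambda>\<gamma>. \<eta> m \<gamma> - \<eta> N \<gamma>)" if m: "m \<ge> N" for m
    proof -
      obtain c where "fibre_bound G c (\<lambda>\<gamma>. \<eta> m \<gamma> - \<eta> N \<gamma>)"
        using Cc_fibre_bound[OF Cc_diff[OF \<eta>(1) \<eta>(1)]] by blast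
      from fibre_bound_mono[OF fibre_bound_L2_norm[OF this]] N[OF m order_refl]
      show ?thesis by simp
    qed
    then have "fibre_bound G \<epsilon> (\<lambda>\<gamma>. \<xi> \<gamma> - \<eta> N \<gamma>)"
      using \<eta>(3) by (intro fibre_bound_limit[of "\<lambda>m \<gamma>. \<eta> m \<gamma> - \<eta> N \<gamma>" _ sequentially])
        (auto intro!: tendsto_intros simp: eventually_sequentially)
    then show "\<exists>\<eta>\<in>Cc. fibre_bound G \<epsilon> (\<lambda>\<gamma>. \<xi> \<gamma> - \<eta> \<gamma>)" using \<eta>(1) by blast
  qed
next
  assume *: "\<forall>\<epsilon>>0. \<exists>\<eta>\<in>Cc. fibre_bound G \<epsilon> (\<lambda>\<gamma>. \<xi> \<gamma> - \<eta> \<gamma>)"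
  have "\<forall>n. \<exists>\<eta>. \<eta> \<in> Cc \<and> fibre_bound G (1 / real (Suc n)) (\<lambda>\<gamma>. \<xi> \<gamma> - \<eta> \<gamma>)"
  proof
    fix n
    show "\<exists>\<eta>. \<eta> \<in> Cc \<and> fibre_bound G (1 / real (Suc n)) (\<lambda>\<gamma>. \<xi> \<gamma> - \<eta> \<gamma>)"
      using *[rule_format, of "1 / real (Suc n)"] by auto
  qed
  then obtain \<eta> where \<eta>: "\<forall>n. \<eta> n \<in> Cc \<and> fibre_bound G (1 / real (Suc n)) (\<lambda>\<gamma>. \<xi> \<gamma> - \<eta> n \<gamma>)"
    using choice[of "\<lambda>n \<eta>. \<eta> \<in> Cc \<and> fibre_bound G (1 / real (Suc n)) (\<lambda>\<gamma>. \<xi> \<gamma> - \<eta> \<gamma>)"] by auto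
  have lim: "(\<lambda>n. 1 / real (Suc n)) \<longlonglongrightarrow> 0"
    using LIMSEQ_inverse_real_of_nat by (simp add: inverse_eq_divide)
  have diff: "L2_norm G (\<lambda>\<gamma>. \<eta> m \<gamma> - \<eta> n \<gamma>) \<le> 1 / real (Suc n) + 1 / real (Suc m)" for m n
  proof (rule L2_norm_le)
    have "fibre_bound G (1 / real (Suc n) + 1 / real (Suc m))
        (\<lambda>\<gamma>. (\<xi> \<gamma> - \<eta> n \<gamma>) - (\<xi> \<gamma> - \<eta> m \<gamma>))"
      using \<eta> by (intro fibre_bound_diff) auto
    then show "fibre_bound G (1 / real (Suc n) + 1 / real (Suc m)) (\<lambda>\<gamma>. \<eta> m \<gamma> - \<eta> n \<gamma>)"
      by simp
  qed
  have "\<exists>N. \<forall>m\<ge>N. \<forall>n\<ge>N. L2_norm G (\<lambda>\<gamma>. \<eta> m \<gamma> - \<eta> n \<gamma>) < \<epsilon>" if "\<epsilon> > 0" for \<epsilon>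
  proof -
    obtain N where N: "1 / real (Suc N) < \<epsilon> / 2"
      using reals_Archimedean[OF half_gt_zero[OF \<open>\<epsilon> > 0\<close>]] unfolding inverse_eq_divide by blast
    have "1 / real (Suc n) \<le> 1 / real (Suc N)" if "n \<ge> N" for n
      using that by (intro divide_left_mono) auto
    then show ?thesis using N diff by (smt (verit) field_sum_of_halves)
  qed
  moreover have "(\<lambda>n. \<eta> n \<gamma>) \<longlonglongrightarrow> \<xi> \<gamma>" for \<gamma>
  proof -
    have "(\<lambda>n. \<xi> \<gamma> - \<eta> n \<gamma>) \<longlonglongrightarrow> 0"
      by (rule Lim_null_comparison[OF _ lim], rule always_eventually, rule allI, rule fibre_bound_point)
        (use \<eta> in blast)
    then have "(\<lambda>n. \<xi> \<gamma> - (\<xi> \<gamma> - \<eta> n \<gamma>)) \<longlonglongrightarrow> \<xi> \<gamma> - 0"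
      by (intro tendsto_intros)
    then show ?thesis by simp
  qed
  ultimately show "\<xi> \<in> L2 G" unfolding L2_def using \<eta> by blast
qed

text \<open>This is the completeness needed to place the limit built in \<open>gliding_hump\<close>
  inside \<open>L2 G\<close>.\<close>

lemma L2_closed:
  assumes "\<And>\<epsilon>. \<epsilon> > 0 \<Longrightarrow> \<exists>\<eta>\<in>L2 G. fibre_bound G \<epsilon> (\<lambda>\<gamma>. \<xi> \<gamma> - \<eta> \<gamma>)"
  shows "\<xi> \<in> L2 G"
  unfolding L2_iff
proof (intro allI impI)
  fix \<epsilon> :: real assume \<epsilon>: "\<epsilon> > 0"
  then obtain \<eta> where \<eta>: "\<eta> \<in> L2 G" "fibre_bound G (\<epsilon> / 2) (\<lambda>\<gamma>. \<xi> \<gamma> - \<eta> \<gamma>)"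
    using assms half_gt_zero by blast
  from \<eta>(1) \<epsilon> obtain \<zeta> where \<zeta>: "\<zeta> \<in> Cc" "fibre_bound G (\<epsilon> / 2) (\<lambda>\<gamma>. \<eta> \<gamma> - \<zeta> \<gamma>)"
    unfolding L2_iff using half_gt_zero by blast
  from fibre_bound_add[OF \<eta>(2) \<zeta>(2)] \<zeta>(1)
  show "\<exists>\<eta>\<in>Cc. fibre_bound G \<epsilon> (\<lambda>\<gamma>. \<xi> \<gamma> - \<eta> \<gamma>)" by auto
qed

lemma Cc_subset_L2: "\<xi> \<in> Cc \<Longrightarrow> \<xi> \<in> L2 G"
  unfolding L2_iff by (auto intro!: bexI[of _ \<xi>] simp: fibre_bound_def l2_bound_def L2_set_def)

text \<open>An element lies within distance 1 of a function in \<open>Cc\<close>, so it has some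
  finite bound, and then its norm is one.\<close>

lemma L2_fibre_bound:
  assumes "\<xi> \<in> L2 G"
  shows "fibre_bound G (L2_norm G \<xi>) \<xi>"
proof -
  obtain \<eta> where \<eta>: "\<eta> \<in> Cc" "fibre_bound G 1 (\<lambda>\<gamma>. \<xi> \<gamma> - \<eta> \<gamma>)"
    using assms zero_less_one unfolding L2_iff by blast
  obtain c where "fibre_bound G c \<eta>"
    using Cc_fibre_bound[OF \<eta>(1)] by blast
  from fibre_bound_add[OF \<eta>(2) this] have "fibre_bound G (1 + c) \<xi>" by simp
  then show ?thesis by (rule fibre_bound_L2_norm)
qed

lemma L2_norm_le_iff: "\<xi> \<in> L2 G \<Longrightarrow> L2_norm G \<xi> \<le> c \<longleftrightarrow> fibre_bound G c \<xi>"
  using L2_fibre_bound fibre_bound_mono L2_norm_le by blast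

lemma L2_mult:
  assumes "\<xi> \<in> L2 G" "continuous_on UNIV f" "\<And>\<gamma>. cmod (f \<gamma>) \<le> M"
  shows "(\<lambda>\<gamma>. f \<gamma> * \<xi> \<gamma>) \<in> L2 G"
  unfolding L2_iff
proof (intro allI impI)
  fix \<epsilon> :: real assume \<epsilon>: "\<epsilon> > 0"
  have M: "0 \<le> M" using assms(3) norm_ge_zero order_trans by blast
  \<comment> \<open>Dividing by \<open>M + 1\<close> instead of \<open>M\<close> allows
    \<open>M = 0\<close>.\<close>
  then obtain \<eta> where \<eta>: "\<eta> \<in> Cc" "fibre_bound G (\<epsilon> / (M + 1)) (\<lambda>\<gamma>. \<xi> \<gamma> - \<eta> \<gamma>)"
    using assms(1) \<epsilon> unfolding L2_iff by (meson add_nonneg_pos divide_pos_pos zero_less_one)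
  have "fibre_bound G ((M + 1) * (\<epsilon> / (M + 1))) (\<lambda>\<gamma>. f \<gamma> * \<xi> \<gamma> - f \<gamma> * \<eta> \<gamma>)"
  proof (rule fibre_bound_dominated[OF \<eta>(2)])
    show "0 \<le> M + 1" using M by simp
    show "cmod (f \<gamma> * \<xi> \<gamma> - f \<gamma> * \<eta> \<gamma>) \<le> (M + 1) * cmod (\<xi> \<gamma> - \<eta> \<gamma>)" for \<gamma>
      using mult_right_mono[OF order_trans[OF assms(3), of "M + 1"], of "cmod (\<xi> \<gamma> - \<eta> \<gamma>)" \<gamma>]
      by (simp add: right_diff_distrib[symmetric] norm_mult)
  qed
  then have "fibre_bound G \<epsilon> (\<lambda>\<gamma>. f \<gamma> * \<xi> \<gamma> - f \<gamma> * \<eta> \<gamma>)" using M by simp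
  then show "\<exists>\<eta>\<in>Cc. fibre_bound G \<epsilon> (\<lambda>\<gamma>. f \<gamma> * \<xi> \<gamma> - \<eta> \<gamma>)"
    using Cc_mult[OF \<eta>(1) assms(2)] by (rule bexI)
qed

lemma L2_scale: "\<xi> \<in> L2 G \<Longrightarrow> (\<lambda>\<gamma>. a * \<xi> \<gamma>) \<in> L2 G"
  by (rule L2_mult[where M = "cmod a"]) auto

lemma L2_diff:
  assumes "\<xi> \<in> L2 G" "\<eta> \<in> L2 G"
  shows "(\<lambda>\<gamma>. \<xi> \<gamma> - \<eta> \<gamma>) \<in> L2 G"
  unfolding L2_iff
proof (intro allI impI)
  fix \<epsilon> :: real assume "\<epsilon> > 0"
  then obtain \<xi>' \<eta>' where *: "\<xi>' \<in> Cc" "fibre_bound G (\<epsilon> / 2) (\<lambda>\<gamma>. \<xi> \<gamma> - \<xi>' \<gamma>)"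
     "\<eta>' \<in> Cc" "fibre_bound G (\<epsilon> / 2) (\<lambda>\<gamma>. \<eta> \<gamma> - \<eta>' \<gamma>)"
    using assms unfolding L2_iff using half_gt_zero by metis
  have "fibre_bound G \<epsilon> (\<lambda>\<gamma>. \<xi> \<gamma> - \<eta> \<gamma> - (\<xi>' \<gamma> - \<eta>' \<gamma>))"
    using fibre_bound_diff[OF *(2,4)] by (simp add: algebra_simps)
  then show "\<exists>\<zeta>\<in>Cc. fibre_bound G \<epsilon> (\<lambda>\<gamma>. \<xi> \<gamma> - \<eta> \<gamma> - \<zeta> \<gamma>)"
    using Cc_diff[OF *(1,3)] by (rule bexI)
qed

lemma L2_add:
  assumes "\<xi> \<in> L2 G" "\<eta> \<in> L2 G"
  shows "(\<lambda>\<gamma>. \<xi> \<gamma> + \<eta> \<gamma>) \<in> L2 G"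
  using L2_diff[OF assms(1) L2_scale[OF assms(2), of "-1"]] by simp

lemma L2_zero: "(\<lambda>_. 0) \<in> L2 G"
  by (rule Cc_subset_L2) (simp add: Cc_def)

lemma delta_exists: "\<exists>\<phi>\<in>Cc. \<forall>\<beta>\<in>fibre G (src G \<gamma>). \<phi> \<beta> = (if \<beta> = \<gamma> then 1 else 0)"
proof -
  obtain \<phi> :: "'g \<Rightarrow> complex" where "\<phi> \<in> Cc" "\<forall>\<beta>\<in>fibre G (src G \<gamma>). \<phi> \<beta> = restr {\<gamma>} (\<lambda>_. 1) \<beta>"
    using Cc_lift[of "{\<gamma>}" "src G \<gamma>" UNIV "\<lambda>_. 1"] by auto
  then show ?thesis by (intro bexI[of _ \<phi>]) (auto simp: restr_def)
qed

text \<open>The true point mass need not be continuous; a function in \<open>Cc\<close> that agrees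
  with it on the fibre of \<open>\<gamma>\<close> is as good, since inner products at
  \<open>src G \<gamma>\<close> see only that fibre.\<close>

definition delta :: "'g \<Rightarrow> 'g \<Rightarrow> complex" where
  "delta \<gamma> = (SOME \<phi>. \<phi> \<in> Cc \<and> (\<forall>\<beta>\<in>fibre G (src G \<gamma>). \<phi> \<beta> = (if \<beta> = \<gamma> then 1 else 0)))"

lemma delta: "delta \<gamma> \<in> L2 G" "\<beta> \<in> fibre G (src G \<gamma>) \<Longrightarrow> delta \<gamma> \<beta> = (if \<beta> = \<gamma> then 1 else 0)"
proof -
  have "delta \<gamma> \<in> Cc \<and> (\<forall>\<beta>\<in>fibre G (src G \<gamma>). delta \<gamma> \<beta> = (if \<beta> = \<gamma> then 1 else 0))"
    unfolding delta_def by (rule someI_ex[OF delta_exists[unfolded Bex_def]])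
  then show "delta \<gamma> \<in> L2 G" "\<beta> \<in> fibre G (src G \<gamma>) \<Longrightarrow> delta \<gamma> \<beta> = (if \<beta> = \<gamma> then 1 else 0)"
    using Cc_subset_L2 by auto
qed

lemma L2_inner_delta: "L2_inner G (delta \<gamma>) \<xi> (src G \<gamma>) = \<xi> \<gamma>"
proof -
  have "L2_inner G (delta \<gamma>) \<xi> (src G \<gamma>) = (\<Sum>\<^sub>\<infinity>\<beta>\<in>{\<gamma>}. \<xi> \<beta>)"
    unfolding L2_inner_def
    by (rule infsum_cong_neutral) (auto simp: delta fibre_iff)
  then show ?thesis by simp
qed

end

section \<open>Boundedness of adjointable operators\<close>

text \<open>Names an adjoint, from which homogeneity and boundedness of \<open>T\<close> are
  derived. Over a point that is not a unit the adjoint identity compares two sums over the empty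
  set.\<close>

locale adjoint_pair = lc_etale_groupoid G
  for G :: "'g::t2_space groupoid_ops" +
  fixes T S :: "('g \<Rightarrow> complex) \<Rightarrow> 'g \<Rightarrow> complex"
  assumes T_L2: "\<xi> \<in> L2 G \<Longrightarrow> T \<xi> \<in> L2 G"
    and S_L2: "\<xi> \<in> L2 G \<Longrightarrow> S \<xi> \<in> L2 G"
    and adjoint: "\<eta> \<in> L2 G \<Longrightarrow> \<xi> \<in> L2 G \<Longrightarrow> L2_inner G (T \<eta>) \<xi> x = L2_inner G \<eta> (S \<xi>) x"
begin

text \<open>Pairing with \<open>delta \<gamma>\<close> evaluates at \<open>\<gamma>\<close>, and
  conjugate symmetry brings \<open>T\<close> into the first slot, where it can be moved across. The
  right side involves \<open>\<xi>\<close> only on the fibre over \<open>x\<close>.\<close>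

lemma T_kernel:
  assumes "\<xi> \<in> L2 G" "src G \<gamma> = x"
  shows "T \<xi> \<gamma> = L2_inner G (S (delta \<gamma>)) \<xi> x"
proof -
  have "T \<xi> \<gamma> = L2_inner G (delta \<gamma>) (T \<xi>) x"
    using L2_inner_delta[of \<gamma> "T \<xi>"] assms(2) by simp
  also have "\<dots> = cnj (L2_inner G (T \<xi>) (delta \<gamma>) x)"
    by (rule L2_inner_cnj)
  also have "\<dots> = cnj (L2_inner G \<xi> (S (delta \<gamma>)) x)"
    by (simp add: adjoint assms delta)
  also have "\<dots> = L2_inner G (S (delta \<gamma>)) \<xi> x"
    by (rule L2_inner_cnj[symmetric])
  finally show ?thesis .
qed

lemma T_scale: "\<xi> \<in> L2 G \<Longrightarrow> T (\<lambda>\<gamma>. a * \<xi> \<gamma>) = (\<lambda>\<gamma>. a * T \<xi> \<gamma>)"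
  by (rule ext) (simp add: T_kernel[OF _ refl] L2_scale L2_inner_scale)

lemma T_zero: "T (\<lambda>_. 0) = (\<lambda>_. 0)"
  using T_scale[OF L2_zero, of 0] by simp

text \<open>Hellinger--Toeplitz for the Hilbert module by a gliding hump: if \<open>T\<close> were unbounded, the
  functionals \<open>L2_inner G (T (\<xi> n)) _ (x n)\<close>, normalised, would be small on every fixed vector by
  adjointness, yet a series \<open>\<Sum> \<plusminus> 3\<^sup>-\<^sup>n T (\<xi> n)\<close> with suitable signs keeps them large.\<close>

lemma T_unbounded_witness:
  assumes "\<xi> \<in> L2 G" "fibre_bound G 1 \<xi>" "\<not> fibre_bound G M (T \<xi>)" "0 < M"
  shows "\<exists>u x. u \<in> L2 G \<and> fibre_bound G 1 u \<and> 3 / 4 \<le> cmod (L2_inner G u u x) \<and>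
    (\<forall>\<eta> c. \<eta> \<in> L2 G \<and> fibre_bound G c (S \<eta>) \<longrightarrow> cmod (L2_inner G u \<eta> x) \<le> c / M)"
proof -
  define t where "t = L2_norm G (T \<xi>)"
  have bT: "fibre_bound G t (T \<xi>)"
    unfolding t_def by (rule L2_fibre_bound[OF T_L2[OF assms(1)]])
  have t: "M < t"
    using fibre_bound_mono[OF bT, of M] assms(3) by (intro ccontr[of "M < t"]) simp
  then have "0 < t" using assms by simp
  \<comment> \<open>The supremum of the fibre norms need not be attained, so a fibre carrying at
    least 7/8 of it is used; the square 49/64 exceeds the required 3/4.\<close>
  have "\<not> fibre_bound G (7 / 8 * t) (T \<xi>)"
  proof
    assume "fibre_bound G (7 / 8 * t) (T \<xi>)"
    then have "t \<le> 7 / 8 * t" unfolding t_def by (rule L2_norm_le)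
    then show False using \<open>0 < t\<close> by simp
  qed
  then obtain x where x: "\<not> l2_bound (fibre G x) (7 / 8 * t) (T \<xi>)"
    by (auto simp: fibre_bound_def)
  define e where "e = ell2_norm (fibre G x) (T \<xi>)"
  have "7 / 8 * t \<le> e"
  proof (rule ccontr)
    assume "\<not> ?thesis"
    then have "l2_bound (fibre G x) (7 / 8 * t) (T \<xi>)"
      using l2_bound_mono[OF l2_bound_ell2_norm[OF l2_bound_summable[OF fibre_boundD[OF bT]]], of x "7 / 8 * t"]
      by (simp add: e_def)
    then show False using x by simp
  qed
  then have e: "(7 / 8 * t)\<^sup>2 \<le> e\<^sup>2"
    using \<open>0 < t\<close> by (intro power_mono) auto
  define a where "a = complex_of_real (1 / t)"
  define u where "u = (\<lambda>\<gamma>. a * T \<xi> \<gamma>)"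
  have a: "cmod a = 1 / t" using \<open>0 < t\<close> by (simp add: a_def norm_divide)
  \<comment> \<open>The scaling rule concerns the second variable, so conjugate symmetry is applied
    before and after it.\<close>
  have inner_u: "L2_inner G u \<eta> x = cnj a * L2_inner G (T \<xi>) \<eta> x" for \<eta>
    using L2_inner_cnj[of G u \<eta> x] L2_inner_cnj[of G "T \<xi>" \<eta> x] by (simp add: u_def L2_inner_scale)
  show ?thesis
  proof (intro exI conjI allI impI)
    show "u \<in> L2 G" unfolding u_def by (rule L2_scale[OF T_L2[OF assms(1)]])
    show "fibre_bound G 1 u"
      using fibre_bound_scale[OF bT, of a] \<open>0 < t\<close> unfolding u_def a by simp
    have "cmod (L2_inner G u u x) = (1 / t) * ((1 / t) * cmod (L2_inner G (T \<xi>) (T \<xi>) x))"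
      unfolding inner_u by (simp add: u_def L2_inner_scale norm_mult a)
    also have "cmod (L2_inner G (T \<xi>) (T \<xi>) x) = e\<^sup>2"
      unfolding L2_inner_self e_def norm_of_real by simp
    also have "(1 / t) * ((1 / t) * e\<^sup>2) = e\<^sup>2 / t\<^sup>2"
      by (simp add: power2_eq_square)
    also have "\<dots> \<ge> (7 / 8 * t)\<^sup>2 / t\<^sup>2"
      using e by (simp add: divide_right_mono)
    finally have "(7 / 8 * t)\<^sup>2 / t\<^sup>2 \<le> cmod (L2_inner G u u x)" .
    then show "3 / 4 \<le> cmod (L2_inner G u u x)"
      using \<open>0 < t\<close> by (simp add: power2_eq_square)
    fix \<eta> c assume "\<eta> \<in> L2 G \<and> fibre_bound G c (S \<eta>)"
    then have \<eta>: "\<eta> \<in> L2 G" "fibre_bound G c (S \<eta>)" by auto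
    have "cmod (L2_inner G \<xi> (S \<eta>) x) \<le> 1 * c"
      using assms(2) \<eta>(2) by (rule L2_inner_bound)
    \<comment> \<open>Adjointness replaces \<open>T \<xi>\<close> paired with \<open>\<eta>\<close>
      by \<open>\<xi>\<close> paired with \<open>S \<eta>\<close>; the normalisation by
      \<open>t > M\<close> makes the functional small.\<close>
    then have "cmod (L2_inner G u \<eta> x) \<le> c / t"
      unfolding inner_u using \<open>0 < t\<close> by (simp add: norm_mult a adjoint assms \<eta> divide_right_mono)
    also have "\<dots> \<le> c / M"
      using t assms(4) fibre_bound_nonneg[OF \<eta>(2)] by (intro divide_left_mono) auto
    finally show "cmod (L2_inner G u \<eta> x) \<le> c / M" .
  qed
qed

text \<open>The n-th correction is plus or minus \<open>(1 / 3) ^ n\<close> times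
  \<open>u n\<close>, with the sign chosen so that the n-th functional reaches
  \<open>3 / 4 * (1 / 3) ^ n\<close>. All later corrections together have norm at most
  \<open>3 / 2 * (1 / 3) ^ Suc n\<close>, which is \<open>1 / 2 * (1 / 3) ^ n\<close>, so a quarter
  survives.\<close>

lemma gliding_hump:
  assumes u: "\<And>n. u n \<in> L2 G" "\<And>n. fibre_bound G 1 (u n)"
    and large: "\<And>n. 3 / 4 \<le> cmod (L2_inner G (u n) (u n) (x n))"
  shows "\<exists>\<eta>\<in>L2 G. \<forall>n. (1 / 4) * (1 / 3) ^ n \<le> cmod (L2_inner G (u n) \<eta> (x n))"
proof -
  have step: "\<exists>\<eta>'. \<eta>' \<in> L2 G \<and> fibre_bound G ((1 / 3) ^ n) (\<lambda>\<gamma>. \<eta>' \<gamma> - \<eta> \<gamma>) \<and>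
      (3 / 4) * (1 / 3) ^ n \<le> cmod (L2_inner G (u n) \<eta>' (x n))" if \<eta>: "\<eta> \<in> L2 G" for \<eta> n
  proof -
    define w where "w s = (\<lambda>\<gamma>. \<eta> \<gamma> + complex_of_real (s * (1 / 3) ^ n) * u n \<gamma>)" for s :: real
    have w: "w s \<in> L2 G" for s
      unfolding w_def by (intro L2_add L2_scale \<eta> u)
    have diff: "fibre_bound G ((1 / 3) ^ n) (\<lambda>\<gamma>. w s \<gamma> - \<eta> \<gamma>)" if "\<bar>s\<bar> = 1" for s
    proof -
      have "\<bar>s * (1 / 3) ^ n\<bar> = (1 / 3) ^ n"
        using that by (simp add: abs_mult)
      then show ?thesis
        using fibre_bound_scale[OF u(2)[of n], of "complex_of_real (s * (1 / 3) ^ n)"]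
        by (simp add: w_def del: of_real_mult)
    qed
    define A where "A = L2_inner G (u n) \<eta> (x n)"
    define B where "B = complex_of_real ((1 / 3) ^ n) * L2_inner G (u n) (u n) (x n)"
    have inner: "L2_inner G (u n) (w s) (x n) = A + complex_of_real s * B" for s
      unfolding w_def A_def B_def
      by (subst L2_inner_add[OF fibre_boundD[OF L2_fibre_bound] fibre_boundD[OF L2_fibre_bound]
            fibre_boundD[OF L2_fibre_bound]])
        (auto simp: u \<eta> L2_inner_scale intro: L2_scale u)
    have "(3 / 4) * (1 / 3) ^ n \<le> cmod B"
      using large[of n] unfolding B_def by (simp add: norm_mult norm_power norm_divide divide_right_mono field_simps)
    \<comment> \<open>Hence \<open>cmod (A + B)\<close> and \<open>cmod (A - B)\<close> cannot both
      be below \<open>cmod B\<close>: one of the two signs works.\<close>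
    moreover have "2 * cmod B \<le> cmod (A + B) + cmod (A - B)"
    proof -
      have "2 * cmod B = cmod ((A + B) - (A - B))" by (simp add: norm_mult)
      also have "\<dots> \<le> cmod (A + B) + cmod (A - B)" by (rule norm_triangle_ineq4)
      finally show ?thesis .
    qed
    ultimately have "(3 / 4) * (1 / 3) ^ n \<le> cmod (L2_inner G (u n) (w 1) (x n)) \<or>
        (3 / 4) * (1 / 3) ^ n \<le> cmod (L2_inner G (u n) (w (-1)) (x n))"
      unfolding inner by (simp del: norm_minus_cancel) linarith
    then show ?thesis using w diff[of 1] diff[of "-1"] by auto
  qed
  \<comment> \<open>Dependent choice, started at the zero function: the sign at stage
    \<open>n\<close> depends on the partial sum reached so far.\<close>
  have "\<exists>f. \<forall>n. f n \<in> L2 G \<and> (fibre_bound G ((1 / 3) ^ n) (\<lambda>\<gamma>. f (Suc n) \<gamma> - f n \<gamma>) \<and>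
      (3 / 4) * (1 / 3) ^ n \<le> cmod (L2_inner G (u n) (f (Suc n)) (x n)))"
    by (rule dependent_nat_choice) (use L2_zero step in blast)+
  then obtain f where f: "\<And>n. f n \<in> L2 G"
    "\<And>n. fibre_bound G ((1 / 3) ^ n) (\<lambda>\<gamma>. f (Suc n) \<gamma> - f n \<gamma>)"
    "\<And>n. (3 / 4) * (1 / 3) ^ n \<le> cmod (L2_inner G (u n) (f (Suc n)) (x n))"
    by auto
  have tail: "fibre_bound G ((3 / 2) * (1 / 3) ^ n) (\<lambda>\<gamma>. f (n + k) \<gamma> - f n \<gamma>)" for n k
  proof -
    \<comment> \<open>The induction carries the exact partial sum of the geometric series; the
      subtracted term is dropped afterwards.\<close>
    have "fibre_bound G ((3 / 2) * ((1 / 3) ^ n - (1 / 3) ^ (n + k))) (\<lambda>\<gamma>. f (n + k) \<gamma> - f n \<gamma>)"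
    proof (induction k)
      case 0
      then show ?case by (simp add: fibre_bound_def l2_bound_def L2_set_def)
    next
      case (Suc k)
      from fibre_bound_add[OF f(2)[of "n + k"] Suc] show ?case
        by (simp add: algebra_simps)
    qed
    then show ?thesis by (rule fibre_bound_mono) simp
  qed
  have "\<exists>l. (\<lambda>n. f n \<gamma>) \<longlonglongrightarrow> l" for \<gamma>
  proof -
    have "summable (\<lambda>n. f (Suc n) \<gamma> - f n \<gamma>)"
    proof (rule summable_comparison_test')
      show "summable (\<lambda>n. (1 / 3 :: real) ^ n)" by (rule summable_geometric) simp
      show "norm (f (Suc n) \<gamma> - f n \<gamma>) \<le> (1 / 3) ^ n" for n
        by (rule fibre_bound_point[OF f(2)])
    qed
    then have "(\<lambda>n. \<Sum>k<n. f (Suc k) \<gamma> - f k \<gamma>) \<longlonglongrightarrow> (\<Sum>n. f (Suc n) \<gamma> - f n \<gamma>)"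
      by (rule summable_LIMSEQ)
    moreover have "(\<Sum>k<n. f (Suc k) \<gamma> - f k \<gamma>) = f n \<gamma> - f 0 \<gamma>" for n
      by (induction n) auto
    ultimately have "(\<lambda>n. f n \<gamma> - f 0 \<gamma>) \<longlonglongrightarrow> (\<Sum>n. f (Suc n) \<gamma> - f n \<gamma>)"
      by simp
    from tendsto_add[OF this tendsto_const[of "f 0 \<gamma>"]] show ?thesis by auto
  qed
  then obtain \<eta> where \<eta>: "\<And>\<gamma>. (\<lambda>n. f n \<gamma>) \<longlonglongrightarrow> \<eta> \<gamma>" by metis
  \<comment> \<open>Although \<open>\<eta>\<close> is only a pointwise limit, the tail estimates are
    uniform over fibres and survive in it.\<close>
  have \<eta>_tail: "fibre_bound G ((3 / 2) * (1 / 3) ^ n) (\<lambda>\<gamma>. \<eta> \<gamma> - f n \<gamma>)" for n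
  proof (rule fibre_bound_limit[of "\<lambda>k \<gamma>. f (n + k) \<gamma> - f n \<gamma>" _ sequentially])
    show "(\<lambda>k. f (n + k) \<gamma> - f n \<gamma>) \<longlonglongrightarrow> \<eta> \<gamma> - f n \<gamma>" for \<gamma>
      using LIMSEQ_ignore_initial_segment[OF \<eta>[of \<gamma>], of n] by (intro tendsto_intros) (simp add: add.commute)
  qed (use tail in auto)
  have "\<eta> \<in> L2 G"
  proof (rule L2_closed)
    fix \<epsilon> :: real assume "\<epsilon> > 0"
    then obtain n where "(1 / 3 :: real) ^ n < \<epsilon> / (3 / 2)"
      using real_arch_pow_inv[of "\<epsilon> / (3 / 2)" "1 / 3"] by auto
    then have "fibre_bound G \<epsilon> (\<lambda>\<gamma>. \<eta> \<gamma> - f n \<gamma>)"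
      by (intro fibre_bound_mono[OF \<eta>_tail]) simp
    then show "\<exists>\<zeta>\<in>L2 G. fibre_bound G \<epsilon> (\<lambda>\<gamma>. \<eta> \<gamma> - \<zeta> \<gamma>)" using f(1) by blast
  qed
  moreover have "(1 / 4) * (1 / 3) ^ n \<le> cmod (L2_inner G (u n) \<eta> (x n))" for n
  proof -
    have "L2_inner G (u n) (\<lambda>\<gamma>. f (Suc n) \<gamma> + (\<eta> \<gamma> - f (Suc n) \<gamma>)) (x n) =
       L2_inner G (u n) (f (Suc n)) (x n) + L2_inner G (u n) (\<lambda>\<gamma>. \<eta> \<gamma> - f (Suc n) \<gamma>) (x n)"
      by (rule L2_inner_add[OF fibre_boundD[OF u(2)] fibre_boundD[OF L2_fibre_bound[OF f(1)]]
            fibre_boundD[OF \<eta>_tail]])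
    moreover have "cmod (L2_inner G (u n) (\<lambda>\<gamma>. \<eta> \<gamma> - f (Suc n) \<gamma>) (x n)) \<le> 1 * ((3 / 2) * (1 / 3) ^ Suc n)"
      by (rule L2_inner_bound[OF u(2) \<eta>_tail])
    ultimately show ?thesis
      using f(3)[of n] norm_triangle_ineq2[of "L2_inner G (u n) (f (Suc n)) (x n)"
          "- L2_inner G (u n) (\<lambda>\<gamma>. \<eta> \<gamma> - f (Suc n) \<gamma>) (x n)"] by simp
  qed
  ultimately show ?thesis by blast
qed

text \<open>Take witnesses with \<open>M = 4 ^ n\<close>. On the vector \<open>\<eta>\<close> from
  \<open>gliding_hump\<close> the n-th functional is at least a quarter of
  \<open>(1 / 3) ^ n\<close>, but by adjointness at most \<open>c / 4 ^ n\<close> with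
  \<open>c\<close> the norm of \<open>S \<eta>\<close>. Then \<open>(4 / 3) ^ n\<close> would stay
  below \<open>4 * c\<close>.\<close>

lemma T_unit_ball_bounded: "\<exists>C. \<forall>\<xi>\<in>L2 G. fibre_bound G 1 \<xi> \<longrightarrow> fibre_bound G C (T \<xi>)"
proof (rule ccontr)
  assume "\<not> ?thesis"
  then have unb: "\<exists>\<xi>\<in>L2 G. fibre_bound G 1 \<xi> \<and> \<not> fibre_bound G C (T \<xi>)" for C
    by blast
  define Q where "Q n u x \<longleftrightarrow> u \<in> L2 G \<and> fibre_bound G 1 u \<and> 3 / 4 \<le> cmod (L2_inner G u u x) \<and>
    (\<forall>\<eta> c. \<eta> \<in> L2 G \<and> fibre_bound G c (S \<eta>) \<longrightarrow> cmod (L2_inner G u \<eta> x) \<le> c / 4 ^ n)" for n :: nat and u x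
  have "\<forall>n. \<exists>p. Q n (fst p) (snd p)"
  proof
    fix n :: nat
    obtain \<xi> where \<xi>: "\<xi> \<in> L2 G" "fibre_bound G 1 \<xi>" "\<not> fibre_bound G (4 ^ n) (T \<xi>)"
      using unb by blast
    have "\<exists>u x. Q n u x"
      unfolding Q_def by (rule T_unbounded_witness[OF \<xi>]) simp
    then show "\<exists>p. Q n (fst p) (snd p)" by (metis fst_conv snd_conv)
  qed
  then obtain p where "\<forall>n. Q n (fst (p n)) (snd (p n))" by (rule choice[THEN exE])
  then have p: "Q n (fst (p n)) (snd (p n))" for n by simp
  obtain \<eta> where \<eta>: "\<eta> \<in> L2 G"
    "\<forall>n. (1 / 4) * (1 / 3) ^ n \<le> cmod (L2_inner G (fst (p n)) \<eta> (snd (p n)))"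
    using gliding_hump[of "\<lambda>n. fst (p n)" "\<lambda>n. snd (p n)"] p unfolding Q_def by blast
  define c where "c = L2_norm G (S \<eta>)"
  have c: "fibre_bound G c (S \<eta>)"
    unfolding c_def by (rule L2_fibre_bound[OF S_L2[OF \<eta>(1)]])
  have "(4 / 3) ^ n \<le> 4 * c" for n
  proof -
    have "(1 / 4) * (1 / 3) ^ n \<le> c / 4 ^ n"
      using \<eta> p[of n] c unfolding Q_def by (meson order_trans)
    then show ?thesis by (simp add: field_simps power_divide)
  qed
  moreover obtain n where "4 * c < (4 / 3) ^ n"
    using real_arch_pow[of "4 / 3" "4 * c"] by auto
  ultimately show False
    using linorder_not_less by blast
qed

lemma T_bounded:
  "\<exists>C>0. \<forall>\<xi>\<in>L2 G. \<forall>c. fibre_bound G c \<xi> \<longrightarrow> fibre_bound G (C * c) (T \<xi>)"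
proof -
  obtain C where C: "\<And>\<xi>. \<xi> \<in> L2 G \<Longrightarrow> fibre_bound G 1 \<xi> \<Longrightarrow> fibre_bound G C (T \<xi>)"
    using T_unit_ball_bounded by blast
  \<comment> \<open>The maximum makes the constant positive. The case \<open>c = 0\<close> is
    separate because \<open>\<xi>\<close> cannot be normalised; it forces \<open>\<xi>\<close> to
    vanish.\<close>
  have "fibre_bound G (max C 1 * c) (T \<xi>)" if \<xi>: "\<xi> \<in> L2 G" "fibre_bound G c \<xi>" for \<xi> c
  proof (cases "c = 0")
    case True
    then have "\<xi> = (\<lambda>_. 0)" using fibre_bound_point[OF \<xi>(2)] by auto
    then show ?thesis using \<xi>(2) True by (simp add: T_zero)
  next
    case False
    then have c: "0 < c" using fibre_bound_nonneg[OF \<xi>(2)] by simp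
    let ?a = "complex_of_real (1 / c)"
    have "fibre_bound G 1 (\<lambda>\<gamma>. ?a * \<xi> \<gamma>)"
      using fibre_bound_scale[OF \<xi>(2), of ?a] c by (simp add: norm_divide)
    then have "fibre_bound G C (\<lambda>\<gamma>. ?a * T \<xi> \<gamma>)"
      using C[OF L2_scale[OF \<xi>(1), of ?a]] T_scale[OF \<xi>(1), of ?a] by simp
    from fibre_bound_scale[OF this, of "complex_of_real c"] c
    have "fibre_bound G (c * C) (T \<xi>)" by (simp add: mult.assoc[symmetric])
    then show ?thesis by (rule fibre_bound_mono) (use c in \<open>simp add: mult.commute\<close>)
  qed
  moreover have "0 < max C 1" by (simp add: max_def)
  ultimately show ?thesis by blast
qed

end

section \<open>Slices\<close>

lemma ell2_zero: "v \<in> ell2 A \<Longrightarrow> \<gamma> \<notin> A \<Longrightarrow> v \<gamma> = 0"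
  by (simp add: ell2_def)

lemma ell2_norm_zero_mem: "(\<lambda>_. 0) \<in> {v \<in> ell2 A. ell2_norm A v \<le> 1}"
  by (simp add: ell2_def ell2_norm_def)

lemma ell2_add: "v \<in> ell2 A \<Longrightarrow> w \<in> ell2 A \<Longrightarrow> (\<lambda>\<gamma>. v \<gamma> + w \<gamma>) \<in> ell2 A"
  unfolding ell2_iff using l2_bound_add by fastforce

lemma ell2_scale: "v \<in> ell2 A \<Longrightarrow> (\<lambda>\<gamma>. a * v \<gamma>) \<in> ell2 A"
  unfolding ell2_iff using l2_bound_scale by fastforce

lemma l2_bound_restr_subset: "l2_bound A c v \<Longrightarrow> l2_bound A c (restr B v)"
  using l2_bound_dominated[of A c v 1 "restr B v"] by (simp add: restr_def)

lemma ell2_restr: "v \<in> ell2 A \<Longrightarrow> restr B v \<in> ell2 A"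
  unfolding ell2_iff using l2_bound_restr_subset[of A _ v B] by (auto simp: restr_def)

lemma l2_bound_restr:
  assumes "l2_bound A c v"
  shows "l2_bound B c (restr A v)"
proof (rule l2_boundI)
  fix F assume F: "finite F" "F \<subseteq> B"
  have "L2_set (\<lambda>\<gamma>. cmod (restr A v \<gamma>)) F = L2_set (\<lambda>\<gamma>. cmod (v \<gamma>)) (F \<inter> A)"
    unfolding L2_set_def using F
    by (intro arg_cong[where f = sqrt] sum.mono_neutral_cong_right) (auto simp: restr_def)
  also have "\<dots> \<le> c" using F by (intro l2_boundD[OF assms]) auto
  finally show "L2_set (\<lambda>\<gamma>. cmod (restr A v \<gamma>)) F \<le> c" .
qed

lemma restr_ell2_self: "v \<in> ell2 A \<Longrightarrow> restr A v = v"
  by (auto simp: restr_def ell2_zero)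

text \<open>Choose \<open>B\<close> with partial sum within \<open>\<epsilon>\<^sup>2\<close> of the
  total. A finite sum off \<open>B\<close>, added to the one over \<open>B\<close>, still cannot
  exceed the total.\<close>

lemma ell2_tail:
  assumes v: "v \<in> ell2 A" and \<epsilon>: "\<epsilon> > 0"
  shows "\<exists>B. finite B \<and> B \<subseteq> A \<and> l2_bound A \<epsilon> (restr (A - B) v)"
proof -
  have summable: "(\<lambda>\<gamma>. (cmod (v \<gamma>))\<^sup>2) summable_on A"
    using v by (simp add: ell2_def)
  obtain B where B: "finite B" "B \<subseteq> A"
    "dist (\<Sum>\<gamma>\<in>B. (cmod (v \<gamma>))\<^sup>2) (\<Sum>\<^sub>\<infinity>\<gamma>\<in>A. (cmod (v \<gamma>))\<^sup>2) \<le> \<epsilon>\<^sup>2"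
    using has_sum_finite_approximation[OF has_sum_infsum[OF summable], of "\<epsilon>\<^sup>2"] \<epsilon> by auto
  have "(\<Sum>\<gamma>\<in>F. (cmod (restr (A - B) v \<gamma>))\<^sup>2) \<le> \<epsilon>\<^sup>2" if F: "finite F" "F \<subseteq> A" for F
  proof -
    have "(\<Sum>\<gamma>\<in>F. (cmod (restr (A - B) v \<gamma>))\<^sup>2) = (\<Sum>\<gamma>\<in>F - B. (cmod (v \<gamma>))\<^sup>2)"
      using F by (intro sum.mono_neutral_cong_right) (auto simp: restr_def)
    moreover have "(\<Sum>\<gamma>\<in>(F - B) \<union> B. (cmod (v \<gamma>))\<^sup>2) = (\<Sum>\<gamma>\<in>F - B. (cmod (v \<gamma>))\<^sup>2) + (\<Sum>\<gamma>\<in>B. (cmod (v \<gamma>))\<^sup>2)"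
      using F B by (intro sum.union_disjoint) auto
    moreover have "(\<Sum>\<gamma>\<in>(F - B) \<union> B. (cmod (v \<gamma>))\<^sup>2) \<le> (\<Sum>\<^sub>\<infinity>\<gamma>\<in>A. (cmod (v \<gamma>))\<^sup>2)"
      using F B by (intro finite_sum_le_infsum[OF summable]) auto
    ultimately show ?thesis using B(3) by (simp add: dist_real_def)
  qed
  then show ?thesis
    using B \<epsilon> by (intro exI[of _ B]) (simp add: l2_bound_iff_sum)
qed

lemma bounded_ops_ell2_bound:
  assumes "P \<in> bounded_ops_ell2 A"
  shows "\<exists>C\<ge>0. \<forall>v\<in>ell2 A. \<forall>c. l2_bound A c v \<longrightarrow> l2_bound A (C * c) (P v)"
proof -
  obtain C where C: "\<forall>v\<in>ell2 A. ell2_norm A (P v) \<le> C * ell2_norm A v" and P: "P \<in> ell2 A \<rightarrow> ell2 A"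
    using assms unfolding bounded_ops_ell2_def PiE_def by blast
  \<comment> \<open>If \<open>A\<close> is empty the constant \<open>C\<close> may be negative,
    hence the absolute value.\<close>
  have "l2_bound A (\<bar>C\<bar> * c) (P v)" if "v \<in> ell2 A" "l2_bound A c v" for v c
  proof -
    have "ell2_norm A (P v) \<le> C * ell2_norm A v" using C that by blast
    also have "\<dots> \<le> \<bar>C\<bar> * c"
      using ell2_norm_le[OF that(2)] ell2_norm_nonneg[of A v] by (intro mult_mono) auto
    finally show ?thesis
      using P that(1) by (intro l2_bound_mono[OF ell2_l2_bound]) auto
  qed
  then show ?thesis by (intro exI[of _ "\<bar>C\<bar>"]) auto
qed

text \<open>Density of finitely supported functions: additivity leaves only the images of a small
  tail, which boundedness controls. Outside \<open>ell2 A\<close> the operators agree because they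
  are extensional.\<close>

lemma bounded_ops_ell2_eqI:
  assumes P: "P \<in> bounded_ops_ell2 A" and Q: "Q \<in> bounded_ops_ell2 A"
    and eq: "\<And>v B. v \<in> ell2 A \<Longrightarrow> finite B \<Longrightarrow> B \<subseteq> A \<Longrightarrow> P (restr B v) = Q (restr B v)"
  shows "P = Q"
proof (rule PiE_ext)
  show "P \<in> ell2 A \<rightarrow>\<^sub>E ell2 A" "Q \<in> ell2 A \<rightarrow>\<^sub>E ell2 A"
    using P Q by (auto simp: bounded_ops_ell2_def)
  fix v assume v: "v \<in> ell2 A"
  obtain C where C: "C \<ge> 0" "\<forall>v\<in>ell2 A. \<forall>c. l2_bound A c v \<longrightarrow> l2_bound A (C * c) (P v)"
    using bounded_ops_ell2_bound[OF P] by blast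
  obtain D where D: "D \<ge> 0" "\<forall>v\<in>ell2 A. \<forall>c. l2_bound A c v \<longrightarrow> l2_bound A (D * c) (Q v)"
    using bounded_ops_ell2_bound[OF Q] by blast
  have le: "cmod (P v \<gamma> - Q v \<gamma>) \<le> (C + D) * \<epsilon>" if \<epsilon>: "\<epsilon> > 0" and \<gamma>: "\<gamma> \<in> A" for \<epsilon> \<gamma>
  proof -
    obtain B where B: "finite B" "B \<subseteq> A" "l2_bound A \<epsilon> (restr (A - B) v)"
      using ell2_tail[OF v \<epsilon>] by blast
    have split: "v = (\<lambda>\<gamma>. restr B v \<gamma> + restr (A - B) v \<gamma>)"
      using v B(2) by (auto simp: restr_def ell2_zero)
    have add: "R v \<gamma> = R (restr B v) \<gamma> + R (restr (A - B) v) \<gamma>" if "R \<in> bounded_ops_ell2 A" for R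
    proof -
      have "R (\<lambda>\<gamma>. restr B v \<gamma> + restr (A - B) v \<gamma>) = (\<lambda>\<gamma>. R (restr B v) \<gamma> + R (restr (A - B) v) \<gamma>)"
        using that ell2_restr[OF v] unfolding bounded_ops_ell2_def by blast
      then show ?thesis using split by metis
    qed
    have "P v \<gamma> - Q v \<gamma> = P (restr (A - B) v) \<gamma> - Q (restr (A - B) v) \<gamma>"
      by (simp add: add[OF P] add[OF Q] eq[OF v B(1,2)])
    also have "cmod \<dots> \<le> cmod (P (restr (A - B) v) \<gamma>) + cmod (Q (restr (A - B) v) \<gamma>)"
      by (rule norm_triangle_ineq4)
    also have "\<dots> \<le> C * \<epsilon> + D * \<epsilon>"
      using C(2) D(2) ell2_restr[OF v] B(3) \<gamma> by (intro add_mono l2_bound_point[of A]) auto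
    finally show ?thesis by (simp add: distrib_right)
  qed
  show "P v = Q v"
  proof
    fix \<gamma>
    show "P v \<gamma> = Q v \<gamma>"
    proof (cases "\<gamma> \<in> A")
      case True
      have "cmod (P v \<gamma> - Q v \<gamma>) \<le> 0"
      proof (rule field_le_epsilon)
        fix e :: real assume e: "e > 0"
        \<comment> \<open>The summand 1 keeps the denominator positive when both constants are
          0.\<close>
        have "(C + D) * (e / (C + D + 1)) \<le> e"
          using C(1) D(1) e by (simp add: field_simps)
        then show "cmod (P v \<gamma> - Q v \<gamma>) \<le> 0 + e"
          using le[OF _ True, of "e / (C + D + 1)"] C(1) D(1) e by simp
      qed
      then show ?thesis by simp
    next
      case False
      have "P v \<in> ell2 A" "Q v \<in> ell2 A"
        using P Q v by (auto simp: bounded_ops_ell2_def)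
      then show ?thesis using False by (simp add: ell2_zero)
    qed
  qed
qed

section \<open>Slices as integral operators on fibres\<close>

context adjoint_pair
begin

text \<open>The integral operator with the kernel of \<open>T_kernel\<close>, identified with the
  slice in \<open>slice_eq\<close>. It is made extensional because \<open>bounded_ops_ell2\<close>
  asks for it, which gives the uniqueness that \<open>THE\<close> relies on.\<close>

definition slice_op :: "'g \<Rightarrow> ('g \<Rightarrow> complex) \<Rightarrow> 'g \<Rightarrow> complex" where
  "slice_op x = (\<lambda>v\<in>ell2 (fibre G x). restr (fibre G x) (\<lambda>\<gamma>. L2_inner G (S (delta \<gamma>)) v x))"

lemma slice_op_apply:
  "v \<in> ell2 (fibre G x) \<Longrightarrow> \<gamma> \<in> fibre G x \<Longrightarrow> slice_op x v \<gamma> = L2_inner G (S (delta \<gamma>)) v x"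
  by (simp add: slice_op_def restr_def)

lemma slice_op_outside: "v \<in> ell2 (fibre G x) \<Longrightarrow> \<gamma> \<notin> fibre G x \<Longrightarrow> slice_op x v \<gamma> = 0"
  by (simp add: slice_op_def restr_def)

lemma L2_restr: "\<xi> \<in> L2 G \<Longrightarrow> restr (fibre G x) \<xi> \<in> ell2 (fibre G x)"
  by (rule restr_ell2[OF fibre_boundD[OF L2_fibre_bound]])

lemma slice_op_restr:
  assumes "\<xi> \<in> L2 G"
  shows "slice_op x (restr (fibre G x) \<xi>) = restr (fibre G x) (T \<xi>)"
proof
  fix \<gamma>
  show "slice_op x (restr (fibre G x) \<xi>) \<gamma> = restr (fibre G x) (T \<xi>) \<gamma>"
  proof (cases "\<gamma> \<in> fibre G x")
    case True
    then have "slice_op x (restr (fibre G x) \<xi>) \<gamma> = L2_inner G (S (delta \<gamma>)) (restr (fibre G x) \<xi>) x"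
      by (rule slice_op_apply[OF L2_restr[OF assms]])
    also have "\<dots> = L2_inner G (S (delta \<gamma>)) \<xi> x"
      by (rule L2_inner_cong) (simp add: restr_def)
    also have "\<dots> = T \<xi> \<gamma>"
      using True by (intro T_kernel[symmetric] assms) (simp add: fibre_iff)
    finally show ?thesis using True by (simp add: restr_def)
  next
    case False
    then show ?thesis by (simp add: slice_op_outside L2_restr assms) (simp add: restr_def)
  qed
qed

text \<open>Each coordinate of the slice is a summable series over the fibre, and finite cut-offs of
  \<open>v\<close> yield its finite partial sums.\<close>

lemma slice_op_cutoff_tendsto:
  assumes v: "v \<in> ell2 (fibre G x)" and B: "B \<subseteq> fibre G x" and \<gamma>: "\<gamma> \<in> fibre G x"
  shows "((\<lambda>B'. slice_op x (restr B' v) \<gamma>) \<longlongrightarrow> slice_op x (restr B v) \<gamma>) (finite_subsets_at_top B)"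
proof -
  let ?k = "\<lambda>\<beta>. cnj (S (delta \<gamma>) \<beta>) * v \<beta>"
  have slice: "slice_op x (restr B' v) \<gamma> = infsum ?k B'" if "B' \<subseteq> B" for B'
  proof -
    have "slice_op x (restr B' v) \<gamma> = (\<Sum>\<^sub>\<infinity>\<beta>\<in>fibre G x. cnj (S (delta \<gamma>) \<beta>) * restr B' v \<beta>)"
      using slice_op_apply[OF ell2_restr[OF v] \<gamma>] by (simp add: L2_inner_def)
    also have "\<dots> = infsum ?k B'"
      using that B by (intro infsum_cong_neutral) (auto simp: restr_def)
    finally show ?thesis .
  qed
  have "?k summable_on fibre G x"
    by (rule l2_pairing(1)[OF fibre_boundD[OF L2_fibre_bound[OF S_L2[OF delta(1)]]] ell2_l2_bound[OF v]])
  then have "?k summable_on B"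
    using B by (rule summable_on_subset_banach)
  then have "(sum ?k \<longlongrightarrow> infsum ?k B) (finite_subsets_at_top B)"
    using has_sum_infsum has_sum_def by blast
  moreover have "\<forall>\<^sub>F B' in finite_subsets_at_top B. sum ?k B' = slice_op x (restr B' v) \<gamma>"
    by (rule eventually_finite_subsets_at_top_weakI) (simp add: slice)
  ultimately have "((\<lambda>B'. slice_op x (restr B' v) \<gamma>) \<longlongrightarrow> infsum ?k B) (finite_subsets_at_top B)"
    by (rule Lim_transform_eventually)
  then show ?thesis by (simp add: slice)
qed

text \<open>Reduces arbitrary cut-offs to finite ones: for \<open>A\<close> by the definition of
  \<open>l2_bound\<close>, for \<open>B\<close> by coordinatewise convergence along the finite
  subsets.\<close>

lemma slice_op_cutoff_bound:
  assumes v: "v \<in> ell2 (fibre G x)" and AB: "A \<subseteq> fibre G x" "B \<subseteq> fibre G x"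
    and fin: "\<And>A' B'. finite A' \<Longrightarrow> A' \<subseteq> A \<Longrightarrow> finite B' \<Longrightarrow> B' \<subseteq> B \<Longrightarrow>
      L2_set (\<lambda>\<gamma>. cmod (slice_op x (restr B' v) \<gamma>)) A' \<le> c"
  shows "l2_bound A c (slice_op x (restr B v))"
proof (rule l2_bound_limit)
  show "((\<lambda>B'. slice_op x (restr B' v) \<gamma>) \<longlongrightarrow> slice_op x (restr B v) \<gamma>) (finite_subsets_at_top B)"
    if "\<gamma> \<in> A" for \<gamma>
    using that AB by (intro slice_op_cutoff_tendsto v) auto
  show "\<forall>\<^sub>F B' in finite_subsets_at_top B. l2_bound A c (slice_op x (restr B' v))"
    by (rule eventually_finite_subsets_at_top_weakI) (simp add: l2_bound_def fin)
qed simp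

lemma finite_restr_lift:
  assumes "finite B" "B \<subseteq> fibre G x" and v: "l2_bound (fibre G x) c v"
  shows "\<exists>\<xi>\<in>L2 G. fibre_bound G c \<xi> \<and> restr (fibre G x) \<xi> = restr B v"
proof -
  obtain \<xi> where \<xi>: "\<xi> \<in> Cc" "\<forall>\<gamma>\<in>fibre G x. \<xi> \<gamma> = restr B v \<gamma>"
    "fibre_bound G (L2_set (\<lambda>\<gamma>. cmod (v \<gamma>)) B) \<xi>"
    using Cc_lift[OF assms(1,2), of UNIV v] by auto
  have "restr (fibre G x) \<xi> = restr B v"
    using \<xi>(2) assms(2) by (auto simp: restr_def fun_eq_iff)
  then show ?thesis
    using Cc_subset_L2[OF \<xi>(1)] fibre_bound_mono[OF \<xi>(3) l2_boundD[OF v assms(1,2)]] by blast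
qed

text \<open>The constant of \<open>T_bounded\<close> serves every fibre: a finite cut-off lifts to
  \<open>L2 G\<close> without growing, \<open>T\<close> is applied, and the result is
  restricted.\<close>

lemma slice_op_bounded:
  "\<exists>C>0. \<forall>x. \<forall>v\<in>ell2 (fibre G x). \<forall>c. l2_bound (fibre G x) c v \<longrightarrow> l2_bound (fibre G x) (C * c) (slice_op x v)"
proof -
  obtain C where C: "C > 0" "\<forall>\<xi>\<in>L2 G. \<forall>c. fibre_bound G c \<xi> \<longrightarrow> fibre_bound G (C * c) (T \<xi>)"
    using T_bounded by blast
  have "l2_bound (fibre G x) (C * c) (slice_op x v)"
    if v: "v \<in> ell2 (fibre G x)" "l2_bound (fibre G x) c v" for x v c
  proof -
    have "l2_bound (fibre G x) (C * c) (slice_op x (restr (fibre G x) v))"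
    proof (rule slice_op_cutoff_bound[OF v(1) order_refl order_refl])
      fix A' B' assume *: "finite A'" "A' \<subseteq> fibre G x" "finite B'" "B' \<subseteq> fibre G x"
      obtain \<xi> where \<xi>: "\<xi> \<in> L2 G" "fibre_bound G c \<xi>" "restr (fibre G x) \<xi> = restr B' v"
        using finite_restr_lift[OF *(3,4) v(2)] by blast
      have "slice_op x (restr B' v) = restr (fibre G x) (T \<xi>)"
        using slice_op_restr[OF \<xi>(1), of x] \<xi>(3) by simp
      moreover have "l2_bound (fibre G x) (C * c) (restr (fibre G x) (T \<xi>))"
        using C(2) \<xi>(1,2) by (intro l2_bound_restr fibre_boundD) blast
      ultimately show "L2_set (\<lambda>\<gamma>. cmod (slice_op x (restr B' v) \<gamma>)) A' \<le> C * c"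
        using * by (auto dest: l2_boundD)
    qed
    then show ?thesis by (simp add: restr_ell2_self v)
  qed
  then show ?thesis using C(1) by blast
qed

lemma slice_op_scale:
  assumes "v \<in> ell2 (fibre G x)"
  shows "slice_op x (\<lambda>\<gamma>. a * v \<gamma>) = (\<lambda>\<gamma>. a * slice_op x v \<gamma>)"
  using assms ell2_scale[OF assms, of a]
  by (auto simp: slice_op_def restr_def L2_inner_scale)

lemma slice_op_add:
  assumes "v \<in> ell2 (fibre G x)" "w \<in> ell2 (fibre G x)"
  shows "slice_op x (\<lambda>\<gamma>. v \<gamma> + w \<gamma>) = (\<lambda>\<gamma>. slice_op x v \<gamma> + slice_op x w \<gamma>)"
proof -
  have "L2_inner G (S (delta \<gamma>)) (\<lambda>\<gamma>. v \<gamma> + w \<gamma>) x =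
      L2_inner G (S (delta \<gamma>)) v x + L2_inner G (S (delta \<gamma>)) w x" for \<gamma>
    by (rule L2_inner_add[OF fibre_boundD[OF L2_fibre_bound[OF S_L2[OF delta(1)]]]
          ell2_l2_bound[OF assms(1)] ell2_l2_bound[OF assms(2)]])
  then show ?thesis
    using assms ell2_add[OF assms] by (auto simp: slice_op_def restr_def)
qed

lemma slice_op_ell2:
  assumes "v \<in> ell2 (fibre G x)"
  shows "slice_op x v \<in> ell2 (fibre G x)"
proof -
  have "\<exists>c. l2_bound (fibre G x) c (slice_op x v)"
    using slice_op_bounded assms ell2_l2_bound[OF assms] by blast
  then show ?thesis
    using slice_op_outside[OF assms] unfolding ell2_iff by blast
qed

lemma slice_op_bounded_ops: "slice_op x \<in> bounded_ops_ell2 (fibre G x)"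
proof -
  obtain C where C: "\<forall>x. \<forall>v\<in>ell2 (fibre G x). \<forall>c. l2_bound (fibre G x) c v \<longrightarrow> l2_bound (fibre G x) (C * c) (slice_op x v)"
    using slice_op_bounded by blast
  have "slice_op x \<in> ell2 (fibre G x) \<rightarrow>\<^sub>E ell2 (fibre G x)"
    using slice_op_ell2 by (auto simp: slice_op_def)
  moreover have "ell2_norm (fibre G x) (slice_op x v) \<le> C * ell2_norm (fibre G x) v"
    if "v \<in> ell2 (fibre G x)" for v
    using C that ell2_l2_bound[OF that] by (intro ell2_norm_le) blast
  ultimately show ?thesis
    unfolding bounded_ops_ell2_def using slice_op_add slice_op_scale by blast
qed

text \<open>Any competitor is determined on finite cut-offs, since these are restrictions of
  elements of \<open>L2 G\<close>; boundedness does the rest.\<close>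

lemma slice_eq: "slice G x T = slice_op x"
  unfolding slice_def
proof (rule the_equality)
  show "slice_op x \<in> bounded_ops_ell2 (fibre G x) \<and>
      (\<forall>\<xi>\<in>L2 G. slice_op x (restr (fibre G x) \<xi>) = restr (fibre G x) (T \<xi>))"
    using slice_op_bounded_ops slice_op_restr by blast
  fix P assume P: "P \<in> bounded_ops_ell2 (fibre G x) \<and>
      (\<forall>\<xi>\<in>L2 G. P (restr (fibre G x) \<xi>) = restr (fibre G x) (T \<xi>))"
  show "P = slice_op x"
  proof (rule bounded_ops_ell2_eqI)
    fix v B assume v: "v \<in> ell2 (fibre G x)" and B: "finite B" "B \<subseteq> fibre G x"
    obtain \<xi> where "\<xi> \<in> L2 G" "restr (fibre G x) \<xi> = restr B v"
      using finite_restr_lift[OF B ell2_l2_bound[OF v]] by blast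
    then show "P (restr B v) = slice_op x (restr B v)"
      using P slice_op_restr by metis
  qed (use P slice_op_bounded_ops in auto)
qed

end

section \<open>Separated cut-offs and slices\<close>

context lc_etale_groupoid
begin

lemma bcontfun_cutoff:
  assumes "finite F" "F \<subseteq> fibre G x" "open W" "F \<subseteq> W"
  shows "\<exists>f :: 'g \<Rightarrow>\<^sub>C complex. norm f \<le> 1 \<and> (\<forall>\<gamma>\<in>F. apply_bcontfun f \<gamma> = 1) \<and> supp f \<subseteq> W"
proof -
  obtain h :: "'g \<Rightarrow> complex" where h: "h \<in> Cc" "\<forall>\<gamma>\<in>fibre G x. h \<gamma> = restr F (\<lambda>_. 1) \<gamma>"
    "closure {\<gamma>. h \<gamma> \<noteq> 0} \<subseteq> W" "\<forall>M\<ge>0. (\<forall>\<gamma>\<in>F. cmod 1 \<le> M) \<longrightarrow> (\<forall>\<gamma>. cmod (h \<gamma>) \<le> M)"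
    using Cc_lift[OF assms, of "\<lambda>_. 1"] by blast
  have h1: "cmod (h \<gamma>) \<le> 1" for \<gamma>
    using h(4)[rule_format, of 1 \<gamma>] by simp
  have "h \<in> bcontfun"
    using h(1) h1 by (intro bcontfun_normI[where b = 1]) (auto simp: Cc_def)
  then have app: "apply_bcontfun (Bcontfun h) = h"
    by (rule Bcontfun_inverse)
  have "norm (Bcontfun h) \<le> 1"
    by (rule norm_bound) (simp add: app h1)
  moreover have "\<forall>\<gamma>\<in>F. apply_bcontfun (Bcontfun h) \<gamma> = 1"
    using h(2) assms(2) by (auto simp: app restr_def)
  ultimately show ?thesis
    using h(3) by (intro exI[of _ "Bcontfun h"]) (simp add: supp_def app)
qed

text \<open>For each of the finitely many pairs both quotients avoid the closed set
  \<open>K\<close>, and continue to do so on a box around the pair. Combining the boxes gives open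
  sets around \<open>A\<close> and \<open>B\<close> in which the supports can be chosen.\<close>

lemma K_separated_cutoffs:
  assumes K: "closed K" and A: "finite A" "A \<subseteq> fibre G x" and B: "finite B" "B \<subseteq> fibre G x"
    and sep: "A \<inter> set_mul G K B = {}" "set_mul G K A \<inter> B = {}"
  shows "\<exists>f g :: 'g \<Rightarrow>\<^sub>C complex. K_separated G K f g \<and> norm f \<le> 1 \<and> norm g \<le> 1 \<and>
    (\<forall>\<beta>\<in>B. apply_bcontfun f \<beta> = 1) \<and> (\<forall>\<alpha>\<in>A. apply_bcontfun g \<alpha> = 1)"
proof -
  define Q where "Q U V \<longleftrightarrow> open U \<and> open V \<and> (\<forall>u\<in>U. \<forall>v\<in>V. src G u = src G v \<longrightarrow>
    mul G u (ginv G v) \<notin> K \<and> mul G v (ginv G u) \<notin> K)" for U V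
  have pair: "\<exists>W. \<alpha> \<in> fst W \<and> \<beta> \<in> snd W \<and> Q (fst W) (snd W)" if \<alpha>\<beta>: "\<alpha> \<in> A" "\<beta> \<in> B" for \<alpha> \<beta>
  proof -
    have src: "src G \<alpha> = src G \<beta>"
      using \<alpha>\<beta> A(2) B(2) by (auto simp: fibre_def)
    have "mul G \<alpha> (ginv G \<beta>) \<notin> K" "mul G \<beta> (ginv G \<alpha>) \<notin> K"
      using sep \<alpha>\<beta> src set_mul_disjoint_iff[of K B A] set_mul_disjoint_iff[of K A B]
      by (metis inf_commute)+
    note notin = this
    obtain U V where UV: "open U" "open V" "\<alpha> \<in> U" "\<beta> \<in> V"
      "\<And>u v. u \<in> U \<Longrightarrow> v \<in> V \<Longrightarrow> src G u = src G v \<Longrightarrow> mul G u (ginv G v) \<notin> K"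
      using quotient_avoids_closed[OF K src notin(1)] by metis
    obtain V' U' where UV': "open V'" "open U'" "\<beta> \<in> V'" "\<alpha> \<in> U'"
      "\<And>u v. u \<in> V' \<Longrightarrow> v \<in> U' \<Longrightarrow> src G u = src G v \<Longrightarrow> mul G u (ginv G v) \<notin> K"
      using quotient_avoids_closed[OF K src[symmetric] notin(2)] by metis
    show ?thesis
      using UV UV' by (intro exI[of _ "(U \<inter> U', V \<inter> V')"]) (auto simp: Q_def)
  qed
  have "\<exists>W. \<forall>\<alpha>\<in>A. \<forall>\<beta>\<in>B. \<alpha> \<in> fst (W \<alpha> \<beta>) \<and> \<beta> \<in> snd (W \<alpha> \<beta>) \<and> Q (fst (W \<alpha> \<beta>)) (snd (W \<alpha> \<beta>))"
    using pair by metis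
  then obtain W where W: "\<And>\<alpha> \<beta>. \<alpha> \<in> A \<Longrightarrow> \<beta> \<in> B \<Longrightarrow>
    \<alpha> \<in> fst (W \<alpha> \<beta>) \<and> \<beta> \<in> snd (W \<alpha> \<beta>) \<and> Q (fst (W \<alpha> \<beta>)) (snd (W \<alpha> \<beta>))"
    by blast
  \<comment> \<open>A point of \<open>U\<close> lies in the boxes of one \<open>\<alpha>\<close>
    against all \<open>\<beta>\<close>, a point of \<open>V\<close> in those of one
    \<open>\<beta>\<close> against all \<open>\<alpha>\<close>. Any two such points thus share the
    box of one pair; finiteness keeps the intersections open.\<close>
  define U where "U = (\<Union>\<alpha>\<in>A. \<Inter>\<beta>\<in>B. fst (W \<alpha> \<beta>))"
  define V where "V = (\<Union>\<beta>\<in>B. \<Inter>\<alpha>\<in>A. snd (W \<alpha> \<beta>))"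
  have "open U" "open V"
    unfolding U_def V_def using A(1) B(1) W by (auto simp: Q_def intro!: open_UN open_INT)
  moreover have "A \<subseteq> U" "B \<subseteq> V"
    unfolding U_def V_def using W by auto
  ultimately obtain f g :: "'g \<Rightarrow>\<^sub>C complex" where
    f: "norm f \<le> 1" "\<forall>\<beta>\<in>B. apply_bcontfun f \<beta> = 1" "supp f \<subseteq> V" and
    g: "norm g \<le> 1" "\<forall>\<alpha>\<in>A. apply_bcontfun g \<alpha> = 1" "supp g \<subseteq> U"
    using bcontfun_cutoff[OF A, of U] bcontfun_cutoff[OF B, of V] by metis
  have UV: "mul G u (ginv G v) \<notin> K \<and> mul G v (ginv G u) \<notin> K"
    if uv: "u \<in> U" "v \<in> V" "src G u = src G v" for u v
  proof -
    obtain \<alpha> \<beta> where "\<alpha> \<in> A" "\<beta> \<in> B" "u \<in> fst (W \<alpha> \<beta>)" "v \<in> snd (W \<alpha> \<beta>)"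
      using uv unfolding U_def V_def by blast
    then show ?thesis using W[of \<alpha> \<beta>] uv(3) unfolding Q_def by blast
  qed
  have "set_mul G K (supp f) \<inter> supp g = {}"
    unfolding set_mul_disjoint_iff using UV f(3) g(3) by blast
  moreover have "set_mul G K (supp g) \<inter> supp f = {}"
    unfolding set_mul_disjoint_iff using UV f(3) g(3) by (metis subsetD)
  ultimately have "K_separated G K f g"
    by (auto simp: K_separated_def)
  then show ?thesis using f g by blast
qed

lemma bcontfun_mult_L2: "\<xi> \<in> L2 G \<Longrightarrow> (\<lambda>\<gamma>. apply_bcontfun f \<gamma> * \<xi> \<gamma>) \<in> L2 G"
  by (rule L2_mult[where M = "norm f"]) (auto simp: norm_bounded)

lemma bcontfun_mult_fibre_bound:
  "fibre_bound G c \<xi> \<Longrightarrow> fibre_bound G (norm f * c) (\<lambda>\<gamma>. apply_bcontfun f \<gamma> * \<xi> \<gamma>)"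
  by (erule fibre_bound_dominated) (auto simp: norm_mult norm_bounded mult_right_mono)

end

lemma compress_apply: "compress g T f \<xi> = (\<lambda>\<gamma>. g \<gamma> * T (\<lambda>\<gamma>. f \<gamma> * \<xi> \<gamma>) \<gamma>)"
  by (simp add: compress_def mult_op_def)

lemma compress_indicator: "compress (indicator A) P (indicator B) v = restr A (P (restr B v))"
  by (auto simp: compress_def mult_op_def restr_def indicator_def fun_eq_iff if_distrib
      intro!: arg_cong[where f = "\<lambda>w. P w _"] cong: if_cong)

lemma supp_nonzero: "apply_bcontfun f \<gamma> \<noteq> 0 \<Longrightarrow> \<gamma> \<in> supp f"
  unfolding supp_def by (rule subsetD[OF closure_subset]) simp

section \<open>Compressions of \<open>T\<close> compared with cut-off slices\<close>

context adjoint_pair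
begin

lemma compress_L2: "\<xi> \<in> L2 G \<Longrightarrow> compress (apply_bcontfun g) T (apply_bcontfun f) \<xi> \<in> L2 G"
  unfolding compress_apply by (intro bcontfun_mult_L2 T_L2)

text \<open>The supremum in \<open>op_norm\<close> dominates its members only once the set is
  bounded above; boundedness of \<open>T\<close> provides this.\<close>

lemma compress_norm_bdd:
  "bdd_above ((\<lambda>\<xi>. L2_norm G (compress (apply_bcontfun g) T (apply_bcontfun f) \<xi>)) `
     {\<xi> \<in> L2 G. L2_norm G \<xi> \<le> 1})"
proof -
  obtain C where C: "\<forall>\<xi>\<in>L2 G. \<forall>c. fibre_bound G c \<xi> \<longrightarrow> fibre_bound G (C * c) (T \<xi>)"
    using T_bounded by blast
  have "L2_norm G (compress (apply_bcontfun g) T (apply_bcontfun f) \<xi>) \<le> norm g * (C * (norm f * 1))"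
    if "\<xi> \<in> {\<xi> \<in> L2 G. L2_norm G \<xi> \<le> 1}" for \<xi>
  proof -
    have \<xi>: "\<xi> \<in> L2 G" "fibre_bound G 1 \<xi>"
      using that L2_norm_le_iff by auto
    show ?thesis
      unfolding compress_apply
      using C bcontfun_mult_L2[OF \<xi>(1)] bcontfun_mult_fibre_bound[OF \<xi>(2)]
      by (intro L2_norm_le bcontfun_mult_fibre_bound) blast
  qed
  then show ?thesis by (rule bdd_aboveI2)
qed

text \<open>Both cut-offs come for free: \<open>f\<close> times \<open>\<xi>\<close> vanishes off
  \<open>supp f\<close>, and where \<open>g\<close> is nonzero the point lies in
  \<open>supp g\<close>.\<close>

lemma compress_on_fibre:
  assumes "\<xi> \<in> L2 G" and \<gamma>: "\<gamma> \<in> fibre G x"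
  shows "compress (apply_bcontfun g) T (apply_bcontfun f) \<xi> \<gamma> = apply_bcontfun g \<gamma> *
    restr (supp g \<inter> fibre G x) (slice_op x (restr (supp f \<inter> fibre G x)
      (restr (fibre G x) (\<lambda>\<gamma>. apply_bcontfun f \<gamma> * \<xi> \<gamma>)))) \<gamma>"
proof (cases "apply_bcontfun g \<gamma> = 0")
  case False
  let ?v = "restr (fibre G x) (\<lambda>\<gamma>. apply_bcontfun f \<gamma> * \<xi> \<gamma>)"
  have "restr (supp f \<inter> fibre G x) ?v = ?v"
    using supp_nonzero[of f] by (auto simp: restr_def fun_eq_iff)
  then show ?thesis
    using supp_nonzero[OF False] \<gamma>
    by (simp add: compress_apply slice_op_restr bcontfun_mult_L2 assms) (use \<gamma> in \<open>simp add: restr_def\<close>)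
qed (simp add: compress_apply)

lemma K_separated_fibres:
  assumes "K_separated G K f g"
  shows "(supp g \<inter> fibre G x) \<inter> set_mul G K (supp f \<inter> fibre G x) = {}"
    "set_mul G K (supp g \<inter> fibre G x) \<inter> (supp f \<inter> fibre G x) = {}"
  using assms unfolding K_separated_def set_mul_def by blast+

text \<open>Carries estimates from \<open>T\<close> to slices in both equivalences. Only finite
  \<open>A'\<close> and \<open>B'\<close> matter; they are fattened to \<open>K\<close>-separated
  \<open>f\<close> and \<open>g\<close> equal to 1 on them, and for a lift \<open>\<xi>\<close> of
  the cut-off \<open>v\<close> the compression has the wanted entries on \<open>A'\<close>.\<close>

lemma slice_compress_bound:
  assumes K: "closed K" and AB: "A \<subseteq> fibre G x" "B \<subseteq> fibre G x"
    and sep: "A \<inter> set_mul G K B = {}" "set_mul G K A \<inter> B = {}"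
    and v: "v \<in> ell2 (fibre G x)" "l2_bound (fibre G x) c v"
    and bound: "\<And>f g \<xi>. K_separated G K f g \<Longrightarrow> norm f \<le> 1 \<Longrightarrow> norm g \<le> 1 \<Longrightarrow> \<xi> \<in> L2 G \<Longrightarrow>
      fibre_bound G c \<xi> \<Longrightarrow> fibre_bound G d (compress (apply_bcontfun g) T (apply_bcontfun f) \<xi>)"
  shows "l2_bound (fibre G x) d (restr A (slice_op x (restr B v)))"
proof (rule l2_bound_restr, rule slice_op_cutoff_bound[OF v(1) AB])
  fix A' B' assume fin: "finite A'" "A' \<subseteq> A" "finite B'" "B' \<subseteq> B"
  then have sub: "A' \<subseteq> fibre G x" "B' \<subseteq> fibre G x" using AB by auto
  have "A' \<inter> set_mul G K B' = {}" "set_mul G K A' \<inter> B' = {}"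
    using sep fin(2,4) unfolding set_mul_def by blast+
  from K_separated_cutoffs[OF K fin(1) sub(1) fin(3) sub(2) this]
  obtain f g :: "'g \<Rightarrow>\<^sub>C complex" where fg: "K_separated G K f g" "norm f \<le> 1" "norm g \<le> 1"
    "\<forall>\<beta>\<in>B'. apply_bcontfun f \<beta> = 1" "\<forall>\<alpha>\<in>A'. apply_bcontfun g \<alpha> = 1"
    by blast
  obtain \<xi> where \<xi>: "\<xi> \<in> L2 G" "fibre_bound G c \<xi>" "restr (fibre G x) \<xi> = restr B' v"
    using finite_restr_lift[OF fin(3) sub(2) v(2)] by blast
  let ?f\<xi> = "\<lambda>\<gamma>. apply_bcontfun f \<gamma> * \<xi> \<gamma>"
  \<comment> \<open>On the fibre \<open>\<xi>\<close> lives on \<open>B'\<close>, where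
    \<open>f\<close> is 1, so multiplication by \<open>f\<close> changes nothing there.\<close>
  have "restr (fibre G x) ?f\<xi> = restr B' v"
  proof
    fix \<gamma>
    show "restr (fibre G x) ?f\<xi> \<gamma> = restr B' v \<gamma>"
      using fun_cong[OF \<xi>(3), of \<gamma>] fg(4) sub(2) by (auto simp: restr_def split: if_splits)
  qed
  then have "slice_op x (restr B' v) = restr (fibre G x) (T ?f\<xi>)"
    using slice_op_restr[OF bcontfun_mult_L2[OF \<xi>(1), of f], of x] by simp
  then have "slice_op x (restr B' v) \<gamma> = compress (apply_bcontfun g) T (apply_bcontfun f) \<xi> \<gamma>"
    if "\<gamma> \<in> A'" for \<gamma>
    using that sub(1) fg(5) by (auto simp: compress_apply restr_def)
  then have "L2_set (\<lambda>\<gamma>. cmod (slice_op x (restr B' v) \<gamma>)) A' =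
      L2_set (\<lambda>\<gamma>. cmod (compress (apply_bcontfun g) T (apply_bcontfun f) \<xi> \<gamma>)) A'"
    by (intro L2_set_cong) auto
  also have "\<dots> \<le> d"
    by (rule l2_boundD[OF fibre_boundD[OF bound[OF fg(1-3) \<xi>(1,2)]] fin(1) sub(1)])
  finally show "L2_set (\<lambda>\<gamma>. cmod (slice_op x (restr B' v) \<gamma>)) A' \<le> d" .
qed

lemma slice_compress_ell2:
  assumes "v \<in> ell2 (fibre G x)"
  shows "restr A (slice_op x (restr B v)) \<in> ell2 (fibre G x)"
  by (intro ell2_restr slice_op_ell2 assms)

lemma slice_compress_norm_bdd:
  "bdd_above ((\<lambda>v. ell2_norm (fibre G x) (restr A (slice_op x (restr B v)))) `
     {v \<in> ell2 (fibre G x). ell2_norm (fibre G x) v \<le> 1})"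
proof -
  obtain C where C: "\<forall>x. \<forall>v\<in>ell2 (fibre G x). \<forall>c. l2_bound (fibre G x) c v \<longrightarrow> l2_bound (fibre G x) (C * c) (slice_op x v)"
    using slice_op_bounded by blast
  have "ell2_norm (fibre G x) (restr A (slice_op x (restr B v))) \<le> C * 1"
    if "v \<in> {v \<in> ell2 (fibre G x). ell2_norm (fibre G x) v \<le> 1}" for v
  proof -
    have v: "v \<in> ell2 (fibre G x)" "l2_bound (fibre G x) 1 v"
      using that l2_bound_mono[OF ell2_l2_bound] by auto
    show ?thesis
      using C ell2_restr[OF v(1)] l2_bound_restr_subset[OF v(2)]
      by (intro ell2_norm_le l2_bound_restr_subset) blast
  qed
  then show ?thesis by (rule bdd_aboveI2)
qed

text \<open>\<open>op_norm\<close> speaks of the unit ball only; other vectors are rescaled by their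
  bound \<open>c\<close>, and \<open>c = 0\<close> forces \<open>v = 0\<close>.\<close>

lemma slice_compress_op_norm:
  assumes d: "op_norm (ell2 (fibre G x)) (ell2_norm (fibre G x)) (\<lambda>v. restr A (slice_op x (restr B v))) \<le> d"
    and v: "v \<in> ell2 (fibre G x)" "l2_bound (fibre G x) c v"
  shows "l2_bound (fibre G x) (d * c) (restr A (slice_op x (restr B v)))"
proof -
  have unit: "l2_bound (fibre G x) d (restr A (slice_op x (restr B w)))"
    if w: "w \<in> ell2 (fibre G x)" "l2_bound (fibre G x) 1 w" for w
  proof -
    have "w \<in> {v \<in> ell2 (fibre G x). ell2_norm (fibre G x) v \<le> 1}"
      using w ell2_norm_le by auto
    from cSUP_upper[OF this slice_compress_norm_bdd[of x A B]]
    have "ell2_norm (fibre G x) (restr A (slice_op x (restr B w))) \<le> d"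
      using d unfolding op_norm_def by linarith
    then show ?thesis
      by (rule l2_bound_mono[OF ell2_l2_bound[OF slice_compress_ell2[OF w(1)]]])
  qed
  have scale: "restr A (slice_op x (restr B (\<lambda>\<gamma>. a * v \<gamma>))) = (\<lambda>\<gamma>. a * restr A (slice_op x (restr B v)) \<gamma>)" for a
  proof -
    have "restr B (\<lambda>\<gamma>. a * v \<gamma>) = (\<lambda>\<gamma>. a * restr B v \<gamma>)"
      by (auto simp: restr_def)
    then show ?thesis
      by (simp add: slice_op_scale ell2_restr v) (auto simp: restr_def)
  qed
  show ?thesis
  proof (cases "c = 0")
    case True
    then have "v = (\<lambda>\<gamma>. 0 * v \<gamma>)"
      using l2_bound_point[OF v(2)] ell2_zero[OF v(1)] by fastforce
    then have "restr A (slice_op x (restr B v)) = (\<lambda>_. 0)"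
      using scale[of 0] by simp
    then show ?thesis using True by (simp add: l2_bound_def L2_set_def)
  next
    case False
    then have c: "0 < c" using l2_bound_nonneg[OF v(2)] by simp
    let ?a = "complex_of_real (1 / c)"
    have "l2_bound (fibre G x) 1 (\<lambda>\<gamma>. ?a * v \<gamma>)"
      using l2_bound_scale[OF v(2), of ?a] c by (simp add: norm_divide)
    from l2_bound_scale[OF unit[OF ell2_scale[OF v(1)] this], of "complex_of_real c"]
    have "l2_bound (fibre G x) (cmod (complex_of_real c) * d)
        (\<lambda>\<gamma>. complex_of_real c * (?a * restr A (slice_op x (restr B v)) \<gamma>))"
      by (simp only: scale)
    moreover have "complex_of_real c * (?a * z) = z" for z
      using c by simp
    ultimately show ?thesis using c by (simp add: mult.commute)
  qed
qed

text \<open>From \<open>T\<close> to slices this is \<open>slice_compress_bound\<close> with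
  \<open>d = 0\<close>. Conversely, the value of the compression at \<open>\<gamma>\<close> is read
  off the fibre of \<open>\<gamma>\<close>, with the traces of the supports as \<open>A\<close> and
  \<open>B\<close>.\<close>

lemma supported_in_iff:
  assumes "closed K"
  shows "supported_in G T K \<longleftrightarrow>
    (\<forall>x\<in>units G. \<forall>A B. A \<subseteq> fibre G x \<and> B \<subseteq> fibre G x \<and>
       A \<inter> set_mul G K B = {} \<and> set_mul G K A \<inter> B = {} \<longrightarrow>
       (\<forall>v\<in>ell2 (fibre G x). restr A (slice_op x (restr B v)) = (\<lambda>_. 0)))"
    (is "_ \<longleftrightarrow> (\<forall>x\<in>units G. \<forall>A B. ?sep x A B \<longrightarrow> ?R x A B)")
proof
  assume supp: "supported_in G T K"
  show "\<forall>x\<in>units G. \<forall>A B. ?sep x A B \<longrightarrow> ?R x A B"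
  proof (intro ballI allI impI)
    fix x A B v assume sep: "?sep x A B" and v: "v \<in> ell2 (fibre G x)"
    have "l2_bound (fibre G x) 0 (restr A (slice_op x (restr B v)))"
    proof (rule slice_compress_bound[OF assms _ _ _ _ v ell2_l2_bound[OF v]])
      fix f g \<xi> assume "K_separated G K f g" "\<xi> \<in> L2 G"
      then have "compress (apply_bcontfun g) T (apply_bcontfun f) \<xi> = (\<lambda>_. 0)"
        using supp unfolding supported_in_def by blast
      then show "fibre_bound G 0 (compress (apply_bcontfun g) T (apply_bcontfun f) \<xi>)"
        by (simp add: fibre_bound_def l2_bound_def L2_set_def)
    qed (use sep in auto)
    then show "restr A (slice_op x (restr B v)) = (\<lambda>_. 0)"
      using l2_bound_point ell2_zero[OF slice_compress_ell2[OF v]] by fastforce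
  qed
next
  assume R: "\<forall>x\<in>units G. \<forall>A B. ?sep x A B \<longrightarrow> ?R x A B"
  show "supported_in G T K"
    unfolding supported_in_def
  proof (intro allI impI ballI ext)
    fix f g :: "'g \<Rightarrow>\<^sub>C complex" and \<xi> \<gamma> assume fg: "K_separated G K f g" and \<xi>: "\<xi> \<in> L2 G"
    define x where "x = src G \<gamma>"
    have "?sep x (supp g \<inter> fibre G x) (supp f \<inter> fibre G x)"
      using K_separated_fibres[OF fg] by blast
    moreover have "x \<in> units G" by (simp add: x_def units_def)
    ultimately have "?R x (supp g \<inter> fibre G x) (supp f \<inter> fibre G x)"
      using R by blast
    moreover have "\<gamma> \<in> fibre G x" by (simp add: x_def)
    ultimately show "compress (apply_bcontfun g) T (apply_bcontfun f) \<xi> \<gamma> = 0"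
      using compress_on_fibre[OF \<xi>] L2_restr[OF bcontfun_mult_L2[OF \<xi>]] by simp
  qed
qed

lemma quasi_local_slices:
  assumes "quasi_local G T" and \<epsilon>: "\<epsilon> > 0"
  shows "\<exists>K. compact K \<and> (\<forall>x\<in>units G. \<forall>A B. A \<subseteq> fibre G x \<and> B \<subseteq> fibre G x \<and>
       A \<inter> set_mul G K B = {} \<and> set_mul G K A \<inter> B = {} \<longrightarrow>
       op_norm (ell2 (fibre G x)) (ell2_norm (fibre G x)) (\<lambda>v. restr A (slice_op x (restr B v))) < \<epsilon>)"
proof -
  let ?n = "\<lambda>f g :: 'g \<Rightarrow>\<^sub>C complex. op_norm (L2 G) (L2_norm G) (compress (apply_bcontfun g) T (apply_bcontfun f))"
  \<comment> \<open>Half of \<open>\<epsilon>\<close> is used because a supremum of strictly bounded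
    numbers obeys only the weak bound. The weak inequality also merges the two branches of the
    definition.\<close>
  obtain K where K: "compact K" "\<And>f g. K_separated G K f g \<Longrightarrow> ?n f g \<le> \<epsilon> / 2 * norm g * norm f"
    using assms(1)[unfolded quasi_local_def Let_def, rule_format, OF half_gt_zero[OF \<epsilon>]]
    by (metis less_imp_le)
  have bound: "fibre_bound G (\<epsilon> / 2) (compress (apply_bcontfun g) T (apply_bcontfun f) \<xi>)"
    if *: "K_separated G K f g" "norm f \<le> 1" "norm g \<le> 1" "\<xi> \<in> L2 G" "fibre_bound G 1 \<xi>" for f g \<xi>
  proof -
    have "norm g * norm f \<le> 1 * 1"
      using *(2,3) by (intro mult_mono) auto
    then have "\<epsilon> / 2 * norm g * norm f \<le> \<epsilon> / 2"
      using mult_left_mono[of "norm g * norm f" 1 "\<epsilon> / 2"] \<epsilon> by (simp add: mult.assoc)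
    moreover have "L2_norm G (compress (apply_bcontfun g) T (apply_bcontfun f) \<xi>) \<le> ?n f g"
      unfolding op_norm_def using *(4,5) L2_norm_le_iff
      by (intro cSUP_upper compress_norm_bdd) auto
    ultimately show ?thesis
      using K(2)[OF *(1)] L2_norm_le_iff[OF compress_L2[OF *(4)]] by (meson order_trans)
  qed
  have small: "op_norm (ell2 (fibre G x)) (ell2_norm (fibre G x)) (\<lambda>v. restr A (slice_op x (restr B v))) < \<epsilon>"
    if sep: "A \<subseteq> fibre G x" "B \<subseteq> fibre G x" "A \<inter> set_mul G K B = {}" "set_mul G K A \<inter> B = {}" for x A B
  proof -
    have "op_norm (ell2 (fibre G x)) (ell2_norm (fibre G x)) (\<lambda>v. restr A (slice_op x (restr B v))) \<le> \<epsilon> / 2"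
      unfolding op_norm_def
    proof (rule cSUP_least)
      show "{v \<in> ell2 (fibre G x). ell2_norm (fibre G x) v \<le> 1} \<noteq> {}"
        using ell2_norm_zero_mem by blast
      fix v assume "v \<in> {v \<in> ell2 (fibre G x). ell2_norm (fibre G x) v \<le> 1}"
      then have v: "v \<in> ell2 (fibre G x)" "l2_bound (fibre G x) 1 v"
        using l2_bound_mono[OF ell2_l2_bound] by auto
      show "ell2_norm (fibre G x) (restr A (slice_op x (restr B v))) \<le> \<epsilon> / 2"
        by (rule ell2_norm_le[OF slice_compress_bound[OF compact_imp_closed[OF K(1)] sep v bound]])
    qed
    then show ?thesis using \<epsilon> by simp
  qed
  show ?thesis
    by (intro exI[of _ K] conjI K(1) ballI allI impI, elim conjE) (rule small)
qed

text \<open>The estimate is made fibre by fibre and is uniform in the fibre: \<open>f\<close>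
  contributes \<open>norm f\<close>, the cut-off slice \<open>\<epsilon> / 2\<close>, and
  \<open>g\<close> contributes \<open>norm g\<close>.\<close>

lemma slices_quasi_local:
  assumes "\<forall>\<epsilon>>0. \<exists>K. compact K \<and> (\<forall>x\<in>units G. \<forall>A B. A \<subseteq> fibre G x \<and> B \<subseteq> fibre G x \<and>
       A \<inter> set_mul G K B = {} \<and> set_mul G K A \<inter> B = {} \<longrightarrow>
       op_norm (ell2 (fibre G x)) (ell2_norm (fibre G x)) (\<lambda>v. restr A (slice_op x (restr B v))) < \<epsilon>)"
  shows "quasi_local G T"
  unfolding quasi_local_def Let_def
proof (intro allI impI)
  fix \<epsilon> :: real assume \<epsilon>: "\<epsilon> > 0"
  let ?n = "\<lambda>f g :: 'g \<Rightarrow>\<^sub>C complex. op_norm (L2 G) (L2_norm G) (compress (apply_bcontfun g) T (apply_bcontfun f))"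
  obtain K where K: "compact K" "\<forall>x\<in>units G. \<forall>A B. A \<subseteq> fibre G x \<and> B \<subseteq> fibre G x \<and>
       A \<inter> set_mul G K B = {} \<and> set_mul G K A \<inter> B = {} \<longrightarrow>
       op_norm (ell2 (fibre G x)) (ell2_norm (fibre G x)) (\<lambda>v. restr A (slice_op x (restr B v))) < \<epsilon> / 2"
    using assms[rule_format, OF half_gt_zero[OF \<epsilon>]] by (elim exE conjE) (rule that; assumption)
  have le: "?n f g \<le> \<epsilon> / 2 * norm g * norm f" if fg: "K_separated G K f g" for f g
    unfolding op_norm_def
  proof (rule cSUP_least)
    show "{\<xi> \<in> L2 G. L2_norm G \<xi> \<le> 1} \<noteq> {}"
      using L2_zero L2_norm_le_iff[OF L2_zero, of 1]
      by (auto simp: fibre_bound_def l2_bound_def L2_set_def)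
    fix \<xi> assume "\<xi> \<in> {\<xi> \<in> L2 G. L2_norm G \<xi> \<le> 1}"
    then have \<xi>: "\<xi> \<in> L2 G" "fibre_bound G 1 \<xi>"
      using L2_norm_le_iff by auto
    show "L2_norm G (compress (apply_bcontfun g) T (apply_bcontfun f) \<xi>) \<le> \<epsilon> / 2 * norm g * norm f"
    proof (rule L2_norm_le, unfold fibre_bound_def, rule allI)
      fix x
      show "l2_bound (fibre G x) (\<epsilon> / 2 * norm g * norm f) (compress (apply_bcontfun g) T (apply_bcontfun f) \<xi>)"
      proof (cases "x \<in> units G")
        case False
        then have "fibre G x = {}" by (auto simp: fibre_def units_def)
        then show ?thesis using \<epsilon> by (simp add: l2_bound_def)
      next
        case True
        let ?v = "restr (fibre G x) (\<lambda>\<gamma>. apply_bcontfun f \<gamma> * \<xi> \<gamma>)"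
        let ?Rv = "restr (supp g \<inter> fibre G x) (slice_op x (restr (supp f \<inter> fibre G x) ?v))"
        have v: "?v \<in> ell2 (fibre G x)" "l2_bound (fibre G x) (norm f * 1) ?v"
          using L2_restr[OF bcontfun_mult_L2[OF \<xi>(1)]] bcontfun_mult_fibre_bound[OF \<xi>(2), of f]
          by (auto intro: l2_bound_restr fibre_boundD)
        have "l2_bound (fibre G x) (\<epsilon> / 2 * (norm f * 1)) ?Rv"
          using K(2)[rule_format, OF True, of "supp g \<inter> fibre G x" "supp f \<inter> fibre G x"] K_separated_fibres[OF fg, of x]
          by (intro slice_compress_op_norm[OF less_imp_le v]) auto
        then have "l2_bound (fibre G x) (norm g * (\<epsilon> / 2 * (norm f * 1)))
            (compress (apply_bcontfun g) T (apply_bcontfun f) \<xi>)"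
          by (rule l2_bound_dominated)
            (simp_all add: compress_on_fibre[OF \<xi>(1)] norm_mult norm_bounded mult_right_mono)
        then show ?thesis by (simp add: mult_ac)
      qed
    qed
  qed
  show "\<exists>K. compact K \<and> (\<forall>f g. K_separated G K f g \<longrightarrow>
      (if f = 0 \<or> g = 0 then ?n f g \<le> \<epsilon> * norm g * norm f else ?n f g < \<epsilon> * norm g * norm f))"
  proof (intro exI[of _ K] conjI allI impI K(1))
    fix f g :: "'g \<Rightarrow>\<^sub>C complex" assume fg: "K_separated G K f g"
    show "if f = 0 \<or> g = 0 then ?n f g \<le> \<epsilon> * norm g * norm f else ?n f g < \<epsilon> * norm g * norm f"
    proof (cases "f = 0 \<or> g = 0")
      case True
      then show ?thesis using le[OF fg] by auto
    next
      case False
      \<comment> \<open>Only for nonzero \<open>f\<close> and \<open>g\<close> does passing from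
        half of \<open>\<epsilon>\<close> to \<open>\<epsilon>\<close> restore strictness.\<close>
      then have "0 < norm g * norm f" by simp
      then have "\<epsilon> / 2 * norm g * norm f < \<epsilon> * norm g * norm f"
        unfolding mult.assoc using \<epsilon> by (intro mult_strict_right_mono) simp_all
      then have "?n f g < \<epsilon> * norm g * norm f"
        by (rule le_less_trans[OF le[OF fg]])
      then show ?thesis by (subst if_not_P[OF False])
    qed
  qed
qed

end

section \<open>Extraction of an adjoint and conclusion\<close>

lemma adjointable_adjoint_pair:
  assumes "lc_etale_groupoid G" "T \<in> adjointable G"
  shows "\<exists>S. adjoint_pair G T S"
proof -
  obtain S where T: "T \<in> L2 G \<rightarrow> L2 G" and S: "S \<in> L2 G \<rightarrow> L2 G"
    and adj: "\<forall>\<eta>\<in>L2 G. \<forall>\<xi>\<in>L2 G. \<forall>x\<in>units G. L2_inner G (T \<eta>) \<xi> x = L2_inner G \<eta> (S \<xi>) x"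
    using assms(2) unfolding adjointable_def by auto
  have "L2_inner G (T \<eta>) \<xi> x = L2_inner G \<eta> (S \<xi>) x" if "\<eta> \<in> L2 G" "\<xi> \<in> L2 G" for \<eta> \<xi> x
  proof (cases "x \<in> units G")
    case False
    then have "fibre G x = {}" by (auto simp: fibre_def units_def)
    then show ?thesis by (simp add: L2_inner_def)
  qed (use adj that in blast)
  then have "adjoint_pair G T S"
    using assms(1) T S by (intro adjoint_pair.intro adjoint_pair_axioms.intro) auto
  then show ?thesis by (intro exI[of _ S])
qed

theorem proposition4p4:
  fixes G :: "'g::t2_space groupoid_ops"
    and T :: "('g \<Rightarrow> complex) \<Rightarrow> ('g \<Rightarrow> complex)"
  assumes "lc_etale_groupoid G"
    and "T \<in> adjointable G"
  shows "(\<forall>K. compact K \<longrightarrow>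
            (supported_in G T K \<longleftrightarrow>
              (\<forall>x\<in>units G. \<forall>A B. A \<subseteq> fibre G x \<and> B \<subseteq> fibre G x \<and>
                 A \<inter> set_mul G K B = {} \<and> set_mul G K A \<inter> B = {} \<longrightarrow>
                 (\<forall>v\<in>ell2 (fibre G x).
                    compress (indicator A) (slice G x T) (indicator B) v = (\<lambda>_. 0)))))
       \<and> (quasi_local G T \<longleftrightarrow>
            (\<forall>\<epsilon>>0. \<exists>K. compact K \<and>
              (\<forall>x\<in>units G. \<forall>A B. A \<subseteq> fibre G x \<and> B \<subseteq> fibre G x \<and>
                 A \<inter> set_mul G K B = {} \<and> set_mul G K A \<inter> B = {} \<longrightarrow>
                 op_norm (ell2 (fibre G x)) (ell2_norm (fibre G x))
                   (compress (indicator A) (slice G x T) (indicator B)) < \<epsilon>)))"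
proof -
  obtain S where "adjoint_pair G T S"
    using adjointable_adjoint_pair[OF assms] by blast
  then interpret adjoint_pair G T S .
  \<comment> \<open>Multiplication by indicators is restriction and the slice is the integral
    operator, which turns both claims into statements about \<open>slice_op\<close>.\<close>
  have compress_slice: "compress (indicator A) (slice G x T) (indicator B) =
      (\<lambda>v. restr A (slice_op x (restr B v)))" for x A B
    by (rule ext) (simp add: compress_indicator slice_eq)
  show ?thesis
    unfolding compress_slice
  proof (rule conjI)
    show "\<forall>K. compact K \<longrightarrow> (supported_in G T K \<longleftrightarrow>
        (\<forall>x\<in>units G. \<forall>A B. A \<subseteq> fibre G x \<and> B \<subseteq> fibre G x \<and>
           A \<inter> set_mul G K B = {} \<and> set_mul G K A \<inter> B = {} \<longrightarrow>
           (\<forall>v\<in>ell2 (fibre G x). restr A (slice_op x (restr B v)) = (\<lambda>_. 0))))"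
      by (intro allI impI supported_in_iff compact_imp_closed)
    show "quasi_local G T \<longleftrightarrow>
        (\<forall>\<epsilon>>0. \<exists>K. compact K \<and>
          (\<forall>x\<in>units G. \<forall>A B. A \<subseteq> fibre G x \<and> B \<subseteq> fibre G x \<and>
             A \<inter> set_mul G K B = {} \<and> set_mul G K A \<inter> B = {} \<longrightarrow>
             op_norm (ell2 (fibre G x)) (ell2_norm (fibre G x)) (\<lambda>v. restr A (slice_op x (restr B v))) < \<epsilon>))"
      by (rule iffI[OF _ slices_quasi_local]) (intro allI impI quasi_local_slices)
  qed
qed

end
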